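(* Let $a\in\mathbb{R}\setminus\{0\}$, $t_0\in\mathbb{R}$, and let $$W_a(t)=e^{-t^2}\begin{pmatrix}1+a^2t^2 & at \\ at & 1\end{pmatrix},\quad t\in\mathbb{R},\qquad \xi^{\pm}=\xi_{a,t_0}^{\pm}=\frac{at_0\pm\sqrt{4+a^2t_0^2}}{2}.$$ For either choice of sign (upper signs throughout or lower signs throughout) let $D_{a,t_0}=\partial^2F_2(t)+\partial^1F_1(t)+\partial^0F_0$ with $$F_2(t)=\begin{pmatrix}-\xi^{\mp}+at_0-at & -1-(a^2t_0)t+a^2t^2 \\ -1 & -\xi^{\mp}+at\end{pmatrix},$$ $$F_1(t)=\begin{pmatrix}-2a+2\xi^{\mp}t & -2t_0-2a\xi^{\mp}+2(2+a^2)t \\ 2t_0 & 2(\xi^{\mp}-at_0)t\end{pmatrix},$$ $$F_0=\begin{pmatrix}\xi^{\mp}+2\frac{t_0}{a} & 2\frac{2+a^2}{a^2} \\ \frac{4}{a^2} & -\xi^{\mp}-2\frac{t_0}{a}\end{pmatrix},$$ and let $$M(a,t_0)=\begin{pmatrix}(\xi^{\pm})^2 & \xi^{\pm} \\ \xi^{\pm} & 1\end{pmatrix}.$$ Then the set $\Upsilon(D_{a,t_0})$ of all $2\times 2$ weight matrices with respect to which $D_{a,t_0}$ is symmetric is $$\Upsilon(D_{a,t_0})=\{\gamma W_a+\zeta\,\delta_{t_0}M(a,t_0):\ \gamma>0,\ \zeta\ge0\}.$$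
   Context: A weight matrix $W$ is an $N\times N$ matrix of measures supported in the real line such that: $W(\Omega)$ is positive semidefinite for every Borel set $\Omega\subset\mathbb{R}$; for every $n\in\mathbb{N}$ the moment $\mu_n=\int t^n\,dW(t)$ exists and is finite; and $\int P(t)\,dW(t)\,P^*(t)$ is nonsingular whenever $P$ is an $N\times N$ matrix polynomial with nonsingular leading coefficient. Here $P^*(t)$ is the conjugate transpose of $P(t)$; in this statement $N=2$. A density $W(t)$ is identified with the matrix of measures $W(t)\,dt$. An operator $D=\partial^2F_2(t)+\partial^1F_1(t)+\partial^0F_0$, $\partial=\frac{d}{dt}$, acts on the right on matrix polynomials: $PD=P''(t)F_2(t)+P'(t)F_1(t)+P(t)F_0$. It is symmetric with respect to $W$ if $\int(PD)\,dW\,Q^*=\int P\,dW\,(QD)^*$ for all matrix polynomials $P,Q$. We write $\Upsilon(D)$ for the set of all weight matrices with respect to which $D$ is symmetric. $\delta_{t_0}$ is the Dirac measure at $t_0$. Sign convention: the symbols $\pm$ and $\mp$ are correlated, i.e. if $M(a,t_0)$ is formed with $\xi^{+}$ then $D_{a,t_0}$ is formed with $\xi^{-}$, and vice versa. *)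

theory Defs
  imports "HOL-Analysis.Analysis"
begin

section \<open>Integration against finite signed and complex Borel measures on the line\<close>

text \<open>
  Signed and complex measures are given as set functions.  The upper variation of a signed
  measure \<open>\<nu>\<close> is \<open>A \<mapsto> sup {\<nu> B | B \<subseteq> A Borel}\<close>; it is the positive part of the Jordan
  decomposition of \<open>\<nu>\<close>, and the negative part is the upper variation of \<open>- \<nu>\<close>.  Truncation of
  negative values by \<^const>\<open>ennreal\<close> is harmless because \<open>B = {}\<close> contributes \<open>0\<close>.
\<close>

definition upper_variation :: "(real set \<Rightarrow> real) \<Rightarrow> real measure" where
  "upper_variation \<nu> =
     measure_of UNIV (sets borel) (\<lambda>A. SUP B\<in>{B \<in> sets borel. B \<subseteq> A}. ennreal (\<nu> B))"

definition signed_integrable :: "(real set \<Rightarrow> real) \<Rightarrow> (real \<Rightarrow> complex) \<Rightarrow> bool" where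
  "signed_integrable \<nu> f \<longleftrightarrow>
     integrable (upper_variation \<nu>) f \<and> integrable (upper_variation (\<lambda>A. - \<nu> A)) f"

definition signed_integral :: "(real set \<Rightarrow> real) \<Rightarrow> (real \<Rightarrow> complex) \<Rightarrow> complex" where
  "signed_integral \<nu> f =
     (LINT t|upper_variation \<nu>. f t) - (LINT t|upper_variation (\<lambda>A. - \<nu> A). f t)"

definition cmeasure_integrable :: "(real set \<Rightarrow> complex) \<Rightarrow> (real \<Rightarrow> complex) \<Rightarrow> bool" where
  "cmeasure_integrable \<nu> f \<longleftrightarrow>
     signed_integrable (\<lambda>A. Re (\<nu> A)) f \<and> signed_integrable (\<lambda>A. Im (\<nu> A)) f"

definition cmeasure_integral :: "(real set \<Rightarrow> complex) \<Rightarrow> (real \<Rightarrow> complex) \<Rightarrow> complex" where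
  "cmeasure_integral \<nu> f =
     signed_integral (\<lambda>A. Re (\<nu> A)) f + \<i> * signed_integral (\<lambda>A. Im (\<nu> A)) f"

section \<open>Matrices, matrix polynomials and matrices of measures\<close>

definition conj_transpose :: "complex^'n^'m \<Rightarrow> complex^'m^'n" where
  "conj_transpose A = (\<chi> i j. cnj (A $ j $ i))"

definition pos_semidef :: "complex^'n^'n \<Rightarrow> bool" where
  "pos_semidef A \<longleftrightarrow> conj_transpose A = A \<and>
     (\<forall>x. 0 \<le> Re (\<Sum>i\<in>UNIV. \<Sum>j\<in>UNIV. cnj (x $ i) * A $ i $ j * x $ j))"

text \<open>Matrix polynomials are matrices of complex polynomials, evaluated at real points.\<close>

definition mpoly_eval :: "complex poly^'n^'n \<Rightarrow> real \<Rightarrow> complex^'n^'n" where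
  "mpoly_eval P t = (\<chi> i j. poly (P $ i $ j) (complex_of_real t))"

definition mpoly_deriv :: "complex poly^'n^'n \<Rightarrow> complex poly^'n^'n" where
  "mpoly_deriv P = (\<chi> i j. pderiv (P $ i $ j))"

definition mpoly_degree :: "complex poly^'n^'n \<Rightarrow> nat" where
  "mpoly_degree P = Max {degree (P $ i $ j) | i j. True}"

definition mpoly_lead_coeff :: "complex poly^'n^'n \<Rightarrow> complex^'n^'n" where
  "mpoly_lead_coeff P = (\<chi> i j. coeff (P $ i $ j) (mpoly_degree P))"

text \<open>
  A matrix of measures is a matrix-valued set function.  All its values are finite, which is no
  restriction here since a weight matrix has a finite zeroth moment.
\<close>

type_synonym 'n matrix_measure = "real set \<Rightarrow> complex^'n^'n"

text \<open>
  As for \<^const>\<open>emeasure\<close>, the value outside the Borel sets is fixed to be \<open>0\<close>, so that two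
  matrices of measures are equal as functions iff they agree on all Borel sets.
\<close>

definition is_matrix_measure :: "'n::finite matrix_measure \<Rightarrow> bool" where
  "is_matrix_measure W \<longleftrightarrow>
     (\<forall>\<Omega>. \<Omega> \<notin> sets borel \<longrightarrow> W \<Omega> = 0) \<and>
     (\<forall>A :: nat \<Rightarrow> real set. range A \<subseteq> sets borel \<longrightarrow> disjoint_family A \<longrightarrow>
        (\<lambda>n. W (A n)) sums W (\<Union>n. A n))"

text \<open>\<open>sandwich_integral F W G\<close> is \<open>\<integral> F(t) dW(t) G\<^sup>*(t)\<close>.\<close>

definition sandwich_integral ::
    "(real \<Rightarrow> complex^'n^'n) \<Rightarrow> 'n::finite matrix_measure \<Rightarrow> (real \<Rightarrow> complex^'n^'n) \<Rightarrow> complex^'n^'n"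
  where
  "sandwich_integral F W G = (\<chi> i j. \<Sum>k\<in>UNIV. \<Sum>l\<in>UNIV.
     cmeasure_integral (\<lambda>\<Omega>. W \<Omega> $ k $ l) (\<lambda>t. F t $ i $ k * conj_transpose (G t) $ l $ j))"

definition weight_matrix :: "'n::finite matrix_measure \<Rightarrow> bool" where
  "weight_matrix W \<longleftrightarrow>
     is_matrix_measure W \<and>
     (\<forall>\<Omega>\<in>sets borel. pos_semidef (W \<Omega>)) \<and>
     (\<forall>(n::nat) i j. cmeasure_integrable (\<lambda>\<Omega>. W \<Omega> $ i $ j) (\<lambda>t. complex_of_real (t ^ n))) \<and>
     (\<forall>P. invertible (mpoly_lead_coeff P) \<longrightarrow>
        invertible (sandwich_integral (mpoly_eval P) W (mpoly_eval P)))"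

section \<open>Second order operators and their symmetry\<close>

text \<open>
  \<open>diff_op F2 F1 F0 P\<close> is the function \<open>t \<mapsto> (PD)(t)\<close> for
  \<open>D = \<partial>\<^sup>2 F\<^sub>2 + \<partial>\<^sup>1 F\<^sub>1 + \<partial>\<^sup>0 F\<^sub>0\<close> acting on the right.
\<close>

definition diff_op ::
    "(real \<Rightarrow> complex^'n^'n) \<Rightarrow> (real \<Rightarrow> complex^'n^'n) \<Rightarrow> complex^'n^'n \<Rightarrow>
     complex poly^'n^'n \<Rightarrow> real \<Rightarrow> complex^'n^'n" where
  "diff_op F2 F1 F0 P t =
     mpoly_eval (mpoly_deriv (mpoly_deriv P)) t ** F2 t +
     mpoly_eval (mpoly_deriv P) t ** F1 t +
     mpoly_eval P t ** F0"

definition symmetric_wrt ::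
    "(complex poly^'n^'n \<Rightarrow> real \<Rightarrow> complex^'n^'n) \<Rightarrow> 'n::finite matrix_measure \<Rightarrow> bool" where
  "symmetric_wrt D W \<longleftrightarrow>
     (\<forall>P Q. sandwich_integral (D P) W (mpoly_eval Q) = sandwich_integral (mpoly_eval P) W (D Q))"

definition Upsilon ::
    "(complex poly^'n^'n \<Rightarrow> real \<Rightarrow> complex^'n^'n) \<Rightarrow> 'n::finite matrix_measure set" where
  "Upsilon D = {W. weight_matrix W \<and> symmetric_wrt D W}"

section \<open>Matrices of measures from densities and Dirac masses\<close>

definition density_measure :: "(real \<Rightarrow> complex^'n^'n) \<Rightarrow> 'n::finite matrix_measure" where
  "density_measure w \<Omega> = (if \<Omega> \<in> sets borel then (LINT t:\<Omega>|lborel. w t) else 0)"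

definition dirac_measure :: "real \<Rightarrow> complex^'n^'n \<Rightarrow> 'n::finite matrix_measure" where
  "dirac_measure t0 M \<Omega> = (if \<Omega> \<in> sets borel then indicat_real \<Omega> t0 *\<^sub>R M else 0)"

section \<open>The concrete weight and operator\<close>

definition cmat2 :: "real \<Rightarrow> real \<Rightarrow> real \<Rightarrow> real \<Rightarrow> complex^2^2" where
  "cmat2 p q r s = vector [vector [complex_of_real p, complex_of_real q],
                           vector [complex_of_real r, complex_of_real s]]"

definition W_density :: "real \<Rightarrow> real \<Rightarrow> complex^2^2" where
  "W_density a t = exp (- (t\<^sup>2)) *\<^sub>R cmat2
     (1 + a\<^sup>2 * t\<^sup>2) (a * t)
     (a * t)         1"

text \<open>
  The sign parameter \<open>s\<close> is \<open>1\<close> or \<open>-1\<close>: \<open>xi s a t0\<close> is \<open>\<xi>\<^sup>+\<close> for \<open>s = 1\<close> and \<open>\<xi>\<^sup>-\<close> for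
  \<open>s = -1\<close>.  The matrix \<open>M_mat s\<close> is formed with \<open>\<xi>\<^sup>\<plusminus> = xi s\<close> and the operator \<open>D_op s\<close> with
  \<open>\<xi>\<^sup>\<mp> = xi (- s)\<close>.
\<close>

definition xi :: "real \<Rightarrow> real \<Rightarrow> real \<Rightarrow> real" where
  "xi s a t0 = (a * t0 + s * sqrt (4 + a\<^sup>2 * t0\<^sup>2)) / 2"

definition F2_mat :: "real \<Rightarrow> real \<Rightarrow> real \<Rightarrow> real \<Rightarrow> complex^2^2" where
  "F2_mat s a t0 t = cmat2
     (- xi (- s) a t0 + a * t0 - a * t)  (- 1 - (a\<^sup>2 * t0) * t + a\<^sup>2 * t\<^sup>2)
     (- 1)                               (- xi (- s) a t0 + a * t)"

definition F1_mat :: "real \<Rightarrow> real \<Rightarrow> real \<Rightarrow> real \<Rightarrow> complex^2^2" where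
  "F1_mat s a t0 t = cmat2
     (- 2 * a + 2 * xi (- s) a t0 * t)  (- 2 * t0 - 2 * a * xi (- s) a t0 + 2 * (2 + a\<^sup>2) * t)
     (2 * t0)                           (2 * (xi (- s) a t0 - a * t0) * t)"

definition F0_mat :: "real \<Rightarrow> real \<Rightarrow> real \<Rightarrow> complex^2^2" where
  "F0_mat s a t0 = cmat2
     (xi (- s) a t0 + 2 * (t0 / a))  (2 * ((2 + a\<^sup>2) / a\<^sup>2))
     (4 / a\<^sup>2)                        (- xi (- s) a t0 - 2 * (t0 / a))"

definition D_op ::
    "real \<Rightarrow> real \<Rightarrow> real \<Rightarrow> complex poly^2^2 \<Rightarrow> real \<Rightarrow> complex^2^2" where
  "D_op s a t0 = diff_op (F2_mat s a t0) (F1_mat s a t0) (F0_mat s a t0)"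

definition M_mat :: "real \<Rightarrow> real \<Rightarrow> real \<Rightarrow> complex^2^2" where
  "M_mat s a t0 = cmat2
     ((xi s a t0)\<^sup>2)  (xi s a t0)
     (xi s a t0)       1"

end

theory Submission
  imports Defs "HOL-Probability.Probability"
begin

text \<open>
  Every matrix of measures enters only through its moment functionals
  \<open>L\<^sub>k\<^sub>l(p) = \<integral> p dW\<^sub>k\<^sub>l\<close>, which are linear on complex polynomials.  Testing the symmetry of an
  operator with coefficients \<open>F\<^sub>2, F\<^sub>1, F\<^sub>0\<close> on rows with a single nonzero entry shows that it is equivalent to three
  distributional identities for the matrix functional \<open>L\<close> (\<open>symmetric_wrt_iff_moment_equations\<close>):
  \<open>F\<^sub>2 L = L F\<^sub>2\<^sup>*\<close>, \<open>2 (F\<^sub>2 L)' = F\<^sub>1 L + L F\<^sub>1\<^sup>*\<close> and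
  \<open>(F\<^sub>2 L)'' - (F\<^sub>1 L)' + F\<^sub>0 L = L F\<^sub>0\<^sup>*\<close>, where derivatives are taken against polynomial test functions.

  For the operator at hand let \<open>c\<close> be the root of \<open>x\<^sup>2 = a t\<^sub>0 x + 1\<close> from which it is formed; the other
  root is \<open>a t\<^sub>0 - c = - 1 / c\<close>.  The first identity expresses
  \<open>L\<^sub>1\<^sub>1\<close> and \<open>L\<^sub>2\<^sub>1\<close> by \<open>L\<^sub>1\<^sub>2\<close> and \<open>L\<^sub>2\<^sub>2\<close>.  In the unknowns \<open>y = L\<^sub>1\<^sub>2 - a t L\<^sub>2\<^sub>2\<close> and
  \<open>z = L\<^sub>2\<^sub>2 + y / c\<close> the entries \<open>(2,2)\<close> and \<open>(1,2)\<close> of the second identity become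
  \<open>c (z' + 2 t z) = 2 (t - t\<^sub>0) y\<close> and \<open>(1 + a c t) (z' + 2 t z) = a (2 t - t\<^sub>0) (t - t\<^sub>0) y\<close>.
  Eliminating \<open>z\<close> gives \<open>(2 + a c t\<^sub>0) (t - t\<^sub>0) y = 0\<close>, and \<open>2 + a c t\<^sub>0 = c\<^sup>2 + 1\<close> is nonzero.  Hence \<open>y\<close> is a
  multiple of evaluation at \<open>t\<^sub>0\<close>, and \<open>z' + 2 t z = 0\<close> makes \<open>z\<close> a multiple of the Gaussian functional
  (\<open>moment_equations_imp_target\<close>).  The third identity is not needed here.
  So the moments of \<open>W\<close> are those of
  \<open>\<gamma> W\<^sub>a + \<zeta> \<delta>\<^sub>t\<^sub>0 M\<close>.  Conversely these moments satisfy all three identities, by polynomial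
  computations (\<open>moment_equations_target\<close>).

  The moments determine the measure: for a vector \<open>v\<close> the positive measure \<open>v\<^sup>* W v\<close>, increased by a
  point mass in case \<open>\<zeta> < 0\<close>, has the moments of a positive measure integrating all exponentials, so its characteristic function is the sum of its moment series
  (\<open>finite_measure_eqI_moments\<close>), and polarization recovers \<open>W\<close>.  Positivity of \<open>W\<close> and nonsingularity of
  \<open>\<integral> (t - t\<^sub>0)\<^sup>2 dW\<close> force \<open>\<gamma> > 0\<close>, and \<open>W {t\<^sub>0} = \<zeta> M\<close> forces \<open>\<zeta> \<ge> 0\<close>.
\<close>


section \<open>Densities and integrals of signed measures\<close>

lemma finite_measure_of_set_function:
  fixes \<nu> :: "real set \<Rightarrow> real"
  assumes nonneg: "\<And>A. A \<in> sets borel \<Longrightarrow> 0 \<le> \<nu> A"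
    and sums: "\<And>A :: nat \<Rightarrow> real set. range A \<subseteq> sets borel \<Longrightarrow> disjoint_family A \<Longrightarrow>
       (\<lambda>n. \<nu> (A n)) sums \<nu> (\<Union>n. A n)"
  obtains M where "finite_measure M" "sets M = sets borel"
    "\<And>A. A \<in> sets borel \<Longrightarrow> measure M A = \<nu> A"
proof -
  define M where "M = measure_of UNIV (sets (borel :: real measure)) (\<lambda>A. ennreal (\<nu> A))"
  have "(\<lambda>n::nat. \<nu> {}) sums \<nu> (\<Union>n::nat. {})"
    using sums[of "\<lambda>_. {}"] by (auto simp: disjoint_family_on_def)
  then have "(\<lambda>n::nat. \<nu> {}) \<longlonglongrightarrow> 0"
    using summable_LIMSEQ_zero sums_summable by blast
  then have \<nu>0: "\<nu> {} = 0"
    by (simp add: LIMSEQ_const_iff)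
  have sM: "sets M = sets borel"
    unfolding M_def using sets.sigma_sets_eq[of "borel :: real measure"] by simp
  have em: "emeasure M A = ennreal (\<nu> A)" if "A \<in> sets borel" for A
  proof (rule emeasure_measure_of[OF M_def])
    show "sets borel \<subseteq> Pow (UNIV :: real set)" by simp
    show "A \<in> sets M" using that sM by simp
    show "positive (sets M) (\<lambda>A. ennreal (\<nu> A))"
      using \<nu>0 by (simp add: positive_def)
    show "countably_additive (sets M) (\<lambda>A. ennreal (\<nu> A))"
    proof (rule countably_additiveI)
      fix B :: "nat \<Rightarrow> real set"
      assume B: "range B \<subseteq> sets M" "disjoint_family B"
      have s: "(\<lambda>n. \<nu> (B n)) sums \<nu> (\<Union>n. B n)"
        using B sM by (intro sums) auto
      have "0 \<le> \<nu> (B n)" for n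
        using B sM by (intro nonneg) auto
      then show "(\<Sum>n. ennreal (\<nu> (B n))) = ennreal (\<nu> (\<Union>n. B n))"
        using s by (intro suminf_ennreal_eq) auto
    qed
  qed
  show thesis
  proof (rule that[of M])
    show "sets M = sets borel" by fact
    have "space M = UNIV" using sets_eq_imp_space_eq[OF sM] by simp
    then show "finite_measure M" using em[of UNIV] by (intro finite_measureI) auto
    show "measure M A = \<nu> A" if "A \<in> sets borel" for A
      using em[OF that] nonneg[OF that] by (simp add: measure_def)
  qed
qed

text \<open>
  \<open>\<nu>\<close> has the real density \<open>g\<close> with respect to the Borel measure \<open>S\<close>.  The set function is constrained
  on Borel sets only, and \<open>S\<close> need not be finite, so that both Lebesgue measure and Dirac measures qualify.
\<close>

definition has_density :: "(real set \<Rightarrow> real) \<Rightarrow> real measure \<Rightarrow> (real \<Rightarrow> real) \<Rightarrow> bool" where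
  "has_density \<nu> S g \<longleftrightarrow> sets S = sets borel \<and> integrable S g \<and>
     (\<forall>A\<in>sets borel. \<nu> A = (LINT t:A|S. g t))"

text \<open>
  Finite signed Borel measures, given as set functions: those with an integrable density with respect to
  some positive measure, equivalently differences of two finite positive measures.
\<close>

definition finite_signed :: "(real set \<Rightarrow> real) \<Rightarrow> bool" where
  "finite_signed \<nu> \<longleftrightarrow> (\<exists>S g. has_density \<nu> S g)"

lemma has_density_uminus: "has_density \<nu> S g \<Longrightarrow> has_density (\<lambda>A. - \<nu> A) S (\<lambda>t. - g t)"
  unfolding has_density_def by (auto simp: set_lebesgue_integral_def)

text \<open>
  The positive part of \<open>g S\<close> is the density of the upper variation: the supremum of \<open>\<nu> B\<close> over \<open>B \<subseteq> A\<close>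
  is attained at the part of \<open>A\<close> on which \<open>g\<close> is positive.
\<close>

lemma upper_variation_eq_density:
  assumes "has_density \<nu> S g"
  shows "upper_variation \<nu> = density S (\<lambda>t. ennreal (g t))"
proof -
  have sS: "sets S = sets borel" and ig: "integrable S g"
    and \<nu>: "\<And>A. A \<in> sets borel \<Longrightarrow> \<nu> A = (LINT t:A|S. g t)"
    using assms by (auto simp: has_density_def)
  have spS: "space S = UNIV" using sets_eq_imp_space_eq[OF sS] by simp
  have mg[measurable]: "g \<in> borel_measurable S" using ig by auto
  have *: "(SUP B\<in>{B \<in> sets borel. B \<subseteq> A}. ennreal (\<nu> B)) = emeasure (density S (\<lambda>t. ennreal (g t))) A"
    if A: "A \<in> sets borel" for A
  proof -
    have em: "emeasure (density S (\<lambda>t. ennreal (g t))) A = ennreal (LINT t:A|S. max 0 (g t))"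
    proof -
      have "emeasure (density S (\<lambda>t. ennreal (g t))) A = (\<integral>\<^sup>+t. ennreal (g t) * indicator A t \<partial>S)"
        using A sS by (intro emeasure_density) auto
      also have "\<dots> = (\<integral>\<^sup>+t. ennreal (indicator A t *\<^sub>R max 0 (g t)) \<partial>S)"
        by (intro nn_integral_cong) (auto split: split_indicator simp: ennreal_max_0)
      also have "\<dots> = ennreal (LINT t|S. indicator A t *\<^sub>R max 0 (g t))"
        using A sS ig by (intro nn_integral_eq_integral integrable_mult_indicator integrable_max) auto
      finally show ?thesis by (simp add: set_lebesgue_integral_def)
    qed
    have le: "ennreal (\<nu> B) \<le> ennreal (LINT t:A|S. max 0 (g t))" if B: "B \<in> sets borel" "B \<subseteq> A" for B
    proof (rule ennreal_leI)
      have "\<nu> B = (LINT t|S. indicator B t *\<^sub>R g t)"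
        using \<nu>[OF B(1)] by (simp add: set_lebesgue_integral_def)
      also have "\<dots> \<le> (LINT t|S. indicator A t *\<^sub>R max 0 (g t))"
        using A B sS ig
        by (intro integral_mono integrable_mult_indicator integrable_max) (auto split: split_indicator)
      finally show "\<nu> B \<le> (LINT t:A|S. max 0 (g t))" by (simp add: set_lebesgue_integral_def)
    qed
    have B0: "A \<inter> {t \<in> space S. 0 < g t} \<in> sets borel"
    proof -
      have "{t \<in> space S. 0 < g t} \<in> sets S" by measurable
      then show ?thesis using A sS by auto
    qed
    have "\<nu> (A \<inter> {t \<in> space S. 0 < g t}) = (LINT t:A|S. max 0 (g t))"
      using \<nu>[OF B0] spS unfolding set_lebesgue_integral_def
      by (auto intro!: Bochner_Integration.integral_cong split: split_indicator)
    then show ?thesis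
      unfolding em using le B0 by (intro antisym SUP_least SUP_upper2[of "A \<inter> {t \<in> space S. 0 < g t}"]) auto
  qed
  have "upper_variation \<nu> = measure_of UNIV (sets borel) (emeasure (density S (\<lambda>t. ennreal (g t))))"
    unfolding upper_variation_def
    using * sets.sigma_sets_eq[of "borel :: real measure"] by (intro measure_of_eq) auto
  also have "\<dots> = density S (\<lambda>t. ennreal (g t))"
    using measure_of_of_measure[of "density S (\<lambda>t. ennreal (g t))"] spS sS by simp
  finally show ?thesis .
qed

lemma integrable_density_real_iff:
  fixes f :: "real \<Rightarrow> complex" and g :: "real \<Rightarrow> real"
  assumes [measurable]: "f \<in> borel_measurable S" "g \<in> borel_measurable S"
  shows "integrable (density S (\<lambda>t. ennreal (g t))) f \<longleftrightarrow> integrable S (\<lambda>t. max 0 (g t) *\<^sub>R f t)"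
    and "(LINT t|density S (\<lambda>t. ennreal (g t)). f t) = (LINT t|S. max 0 (g t) *\<^sub>R f t)"
proof -
  have eq: "density S (\<lambda>t. ennreal (g t)) = density S (\<lambda>t. ennreal (max 0 (g t)))"
    by (simp add: ennreal_max_0)
  show "integrable (density S (\<lambda>t. ennreal (g t))) f \<longleftrightarrow> integrable S (\<lambda>t. max 0 (g t) *\<^sub>R f t)"
    unfolding eq by (rule integrable_density) auto
  show "(LINT t|density S (\<lambda>t. ennreal (g t)). f t) = (LINT t|S. max 0 (g t) *\<^sub>R f t)"
    unfolding eq by (rule integral_density) auto
qed

lemma signed_integral_has_density:
  assumes d: "has_density \<nu> S g" and f: "f \<in> borel_measurable borel"
  shows "signed_integrable \<nu> f \<longleftrightarrow> integrable S (\<lambda>t. g t *\<^sub>R f t)"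
    and "signed_integrable \<nu> f \<Longrightarrow> signed_integral \<nu> f = (LINT t|S. g t *\<^sub>R f t)"
proof -
  have sS: "sets S = sets borel" and ig: "integrable S g"
    using d by (auto simp: has_density_def)
  have mg[measurable]: "g \<in> borel_measurable S" using ig by auto
  have mf[measurable]: "f \<in> borel_measurable S" using f sS by (simp cong: measurable_cong_sets)
  note up = upper_variation_eq_density[OF d] upper_variation_eq_density[OF has_density_uminus[OF d]]
  let ?p = "\<lambda>t. max 0 (g t) *\<^sub>R f t" and ?n = "\<lambda>t. max 0 (- g t) *\<^sub>R f t"
  have split: "g t *\<^sub>R f t = ?p t - ?n t" for t
    by (simp add: max_def)
  have i: "signed_integrable \<nu> f \<longleftrightarrow> integrable S ?p \<and> integrable S ?n"
    unfolding signed_integrable_def up by (simp add: integrable_density_real_iff)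
  have b: "integrable S ?p \<and> integrable S ?n" if "integrable S (\<lambda>t. g t *\<^sub>R f t)"
    using that by (auto elim!: Bochner_Integration.integrable_bound intro!: AE_I2 mult_right_mono)
  show "signed_integrable \<nu> f \<longleftrightarrow> integrable S (\<lambda>t. g t *\<^sub>R f t)"
    unfolding i using b by (auto simp: split simp del: max_def)
  show "signed_integral \<nu> f = (LINT t|S. g t *\<^sub>R f t)" if "signed_integrable \<nu> f"
    using that[unfolded i] unfolding signed_integral_def up split
    by (simp add: integrable_density_real_iff)
qed


lemma has_density_cong:
  assumes "has_density \<nu> S g" and "\<And>A. A \<in> sets borel \<Longrightarrow> \<mu> A = \<nu> A"
  shows "has_density \<mu> S g"
  using assms by (auto simp: has_density_def)

lemma has_density_add:
  assumes "has_density \<nu> S g" "has_density \<mu> S h"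
  shows "has_density (\<lambda>A. \<nu> A + \<mu> A) S (\<lambda>t. g t + h t)"
proof -
  have s: "sets S = sets borel" and g: "integrable S g" and h: "integrable S h"
    using assms by (auto simp: has_density_def)
  have "set_integrable S A g" "set_integrable S A h" if "A \<in> sets borel" for A
    using that s g h unfolding set_integrable_def
    by (auto simp del: real_scaleR_def intro!: integrable_mult_indicator)
  then show ?thesis
    using assms unfolding has_density_def by (auto simp: set_integral_add)
qed

lemma has_density_cmult:
  assumes "has_density \<nu> S g"
  shows "has_density (\<lambda>A. c * \<nu> A) S (\<lambda>t. c * g t)"
  using assms unfolding has_density_def by auto

lemma finite_measure_has_density:
  assumes "finite_measure S" "finite_measure M" and s: "sets S = sets borel" "sets M = sets borel"
    and ac: "\<And>A. A \<in> sets borel \<Longrightarrow> measure S A = 0 \<Longrightarrow> measure M A = 0"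
  shows "\<exists>D. has_density (measure M) S D"
proof -
  interpret S: finite_measure S by fact
  interpret M: finite_measure M by fact
  have ac': "absolutely_continuous S M"
    unfolding absolutely_continuous_def
    using ac s by (auto simp: null_sets_def S.emeasure_eq_measure M.emeasure_eq_measure)
  obtain D where D[measurable]: "D \<in> borel_measurable S"
    and AE: "AE x in S. RN_deriv S M x = ennreal (D x)" and D0: "\<And>x. 0 \<le> D x"
    using S.real_RN_deriv[OF \<open>finite_measure M\<close> ac'] s by metis
  have "density S (RN_deriv S M) = M"
    using s by (intro S.density_RN_deriv ac') auto
  moreover have "density S (RN_deriv S M) = density S (\<lambda>x. ennreal (D x))"
    using AE by (intro density_cong) auto
  ultimately have M: "M = density S (\<lambda>x. ennreal (D x))" by simp
  have em: "emeasure M A = (\<integral>\<^sup>+t. ennreal (indicator A t *\<^sub>R D t) \<partial>S)" if "A \<in> sets borel" for A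
  proof -
    have "emeasure M A = (\<integral>\<^sup>+t. ennreal (D t) * indicator A t \<partial>S)"
      using that s M emeasure_density[of "\<lambda>x. ennreal (D x)" S A] by simp
    also have "\<dots> = (\<integral>\<^sup>+t. ennreal (indicator A t *\<^sub>R D t) \<partial>S)"
      by (intro nn_integral_cong) (auto split: split_indicator)
    finally show ?thesis .
  qed
  have "space S = UNIV" using sets_eq_imp_space_eq[OF s(1)] by simp
  have iD: "integrable S D"
    using em[of UNIV] D0 by (intro integrableI_nonneg) (auto simp: less_top[symmetric])
  have "measure M A = (LINT t:A|S. D t)" if "A \<in> sets borel" for A
    using em[OF that] that s iD D0 unfolding set_lebesgue_integral_def measure_def
    by (subst integral_eq_nn_integral) (auto simp: borel_measurable_indicator)
  then show ?thesis using s iD by (auto simp: has_density_def)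
qed

lemma finite_signed_decomposition:
  assumes "finite_signed \<nu>"
  obtains P N where "finite_measure P" "finite_measure N" "sets P = sets borel" "sets N = sets borel"
    "\<And>A. A \<in> sets borel \<Longrightarrow> \<nu> A = measure P A - measure N A"
proof -
  obtain S g where d: "has_density \<nu> S g" using assms by (auto simp: finite_signed_def)
  then have sS: "sets S = sets borel" and ig: "integrable S g"
    and \<nu>: "\<And>A. A \<in> sets borel \<Longrightarrow> \<nu> A = (LINT t:A|S. g t)"
    by (auto simp: has_density_def)
  have *: "finite_measure (density S (\<lambda>t. ennreal (h t)))"
    "A \<in> sets borel \<Longrightarrow> measure (density S (\<lambda>t. ennreal (h t))) A = (LINT t|S. indicator A t *\<^sub>R max 0 (h t))"
    if h: "integrable S h" for h A
  proof -
    have [measurable]: "h \<in> borel_measurable S" using h by auto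
    have e: "emeasure (density S (\<lambda>t. ennreal (h t))) A = ennreal (LINT t|S. indicator A t *\<^sub>R max 0 (h t))"
      if A: "A \<in> sets borel" for A
    proof -
      have "emeasure (density S (\<lambda>t. ennreal (h t))) A = (\<integral>\<^sup>+t. ennreal (h t) * indicator A t \<partial>S)"
        using A sS by (intro emeasure_density) auto
      also have "\<dots> = (\<integral>\<^sup>+t. ennreal (indicator A t *\<^sub>R max 0 (h t)) \<partial>S)"
        by (intro nn_integral_cong) (auto split: split_indicator simp: ennreal_max_0)
      also have "\<dots> = ennreal (LINT t|S. indicator A t *\<^sub>R max 0 (h t))"
        using A sS h by (intro nn_integral_eq_integral integrable_mult_indicator integrable_max) auto
      finally show ?thesis .
    qed
    have "space S \<in> sets borel" using sets.top[of S] sS by simp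
    then show "finite_measure (density S (\<lambda>t. ennreal (h t)))"
      using e[of "space S"] by (intro finite_measureI) auto
    show "measure (density S (\<lambda>t. ennreal (h t))) A = (LINT t|S. indicator A t *\<^sub>R max 0 (h t))"
      if "A \<in> sets borel"
      unfolding measure_def e[OF that] by (simp add: integral_nonneg_AE)
  qed
  have ig': "integrable S (\<lambda>t. - g t)" using ig by simp
  have "\<nu> A = measure (density S (\<lambda>t. ennreal (g t))) A - measure (density S (\<lambda>t. ennreal (- g t))) A"
    if A: "A \<in> sets borel" for A
  proof -
    have "\<nu> A = (LINT t|S. indicator A t *\<^sub>R max 0 (g t) - indicator A t *\<^sub>R max 0 (- g t))"
      unfolding \<nu>[OF A] set_lebesgue_integral_def
      by (intro Bochner_Integration.integral_cong) (auto split: split_indicator)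
    also have "\<dots> = (LINT t|S. indicator A t *\<^sub>R max 0 (g t)) - (LINT t|S. indicator A t *\<^sub>R max 0 (- g t))"
      using A sS ig by (intro Bochner_Integration.integral_diff integrable_mult_indicator integrable_max) auto
    finally show ?thesis
      using *(2)[OF ig A] *(2)[OF ig' A] by simp
  qed
  then show thesis
    using *(1)[OF ig] *(1)[OF ig'] sS
    by (intro that[of "density S (\<lambda>t. ennreal (g t))" "density S (\<lambda>t. ennreal (- g t))"]) auto
qed

text \<open>
  Two finite signed measures have densities with respect to one common measure, the sum of the four
  parts of their decompositions.  Additivity of \<^const>\<open>signed_integral\<close> in the measure, which is not visible from
  its definition by suprema, reduces by this to additivity of the integral in the density.
\<close>

lemma common_density:
  assumes "finite_signed \<nu>1" "finite_signed \<nu>2"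
  obtains S g1 g2 where "has_density \<nu>1 S g1" "has_density \<nu>2 S g2"
proof -
  obtain P1 N1 where 1: "finite_measure P1" "finite_measure N1" "sets P1 = sets borel" "sets N1 = sets borel"
     "\<And>A. A \<in> sets borel \<Longrightarrow> \<nu>1 A = measure P1 A - measure N1 A"
    using finite_signed_decomposition[OF assms(1)] by blast
  obtain P2 N2 where 2: "finite_measure P2" "finite_measure N2" "sets P2 = sets borel" "sets N2 = sets borel"
     "\<And>A. A \<in> sets borel \<Longrightarrow> \<nu>2 A = measure P2 A - measure N2 A"
    using finite_signed_decomposition[OF assms(2)] by blast
  have sums: "(\<lambda>n. measure M (A n)) sums measure M (\<Union>n. A n)"
    if "finite_measure M" "sets M = sets borel" "range A \<subseteq> sets borel" "disjoint_family A"
    for M and A :: "nat \<Rightarrow> real set"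
    using that by (intro finite_measure.finite_measure_UNION) auto
  obtain S where S: "finite_measure S" "sets S = sets borel"
    "\<And>A. A \<in> sets borel \<Longrightarrow> measure S A = measure P1 A + measure N1 A + (measure P2 A + measure N2 A)"
  proof (rule finite_measure_of_set_function[of "\<lambda>A. measure P1 A + measure N1 A + (measure P2 A + measure N2 A)"])
    show "(\<lambda>n. measure P1 (A n) + measure N1 (A n) + (measure P2 (A n) + measure N2 (A n))) sums
       (measure P1 (\<Union>n. A n) + measure N1 (\<Union>n. A n) + (measure P2 (\<Union>n. A n) + measure N2 (\<Union>n. A n)))"
      if "range A \<subseteq> sets borel" "disjoint_family A" for A :: "nat \<Rightarrow> real set"
      using that by (intro sums_add sums 1 2)
  qed (auto intro!: add_nonneg_nonneg)
  have ac: "\<exists>D. has_density (measure M) S D" if "M \<in> {P1, N1, P2, N2}" for M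
    using that 1 2 S
    by (intro finite_measure_has_density)
       (auto simp: add_nonneg_eq_0_iff)
  obtain p1 n1 p2 n2 where d: "has_density (measure P1) S p1" "has_density (measure N1) S n1"
     "has_density (measure P2) S p2" "has_density (measure N2) S n2"
    using ac by (metis insertCI)
  have "has_density \<nu>1 S (\<lambda>t. p1 t + - n1 t)" "has_density \<nu>2 S (\<lambda>t. p2 t + - n2 t)"
    using has_density_add[OF d(1) has_density_uminus[OF d(2)]]
      has_density_add[OF d(3) has_density_uminus[OF d(4)]]
    by (auto intro: has_density_cong simp: 1 2)
  then show thesis by (rule that)
qed

lemma signed_integrable_add:
  assumes fs: "finite_signed \<nu>1" "finite_signed \<nu>2" and f: "f \<in> borel_measurable borel"
    and i: "signed_integrable \<nu>1 f" "signed_integrable \<nu>2 f"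
  shows "finite_signed (\<lambda>A. \<nu>1 A + \<nu>2 A)" "signed_integrable (\<lambda>A. \<nu>1 A + \<nu>2 A) f"
    "signed_integral (\<lambda>A. \<nu>1 A + \<nu>2 A) f = signed_integral \<nu>1 f + signed_integral \<nu>2 f"
proof -
  obtain S g1 g2 where d: "has_density \<nu>1 S g1" "has_density \<nu>2 S g2"
    using common_density[OF fs] .
  note d' = has_density_add[OF d]
  note int = signed_integral_has_density[OF d(1) f] signed_integral_has_density[OF d(2) f]
    signed_integral_has_density[OF d' f]
  show "finite_signed (\<lambda>A. \<nu>1 A + \<nu>2 A)" using d' by (auto simp: finite_signed_def)
  show *: "signed_integrable (\<lambda>A. \<nu>1 A + \<nu>2 A) f"
    using i by (simp add: int scaleR_add_left)
  show "signed_integral (\<lambda>A. \<nu>1 A + \<nu>2 A) f = signed_integral \<nu>1 f + signed_integral \<nu>2 f"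
    using i * int by (simp add: scaleR_add_left)
qed

lemma signed_integrable_cmult:
  assumes fs: "finite_signed \<nu>" and f: "f \<in> borel_measurable borel" and i: "signed_integrable \<nu> f"
  shows "finite_signed (\<lambda>A. c * \<nu> A)" "signed_integrable (\<lambda>A. c * \<nu> A) f"
    "signed_integral (\<lambda>A. c * \<nu> A) f = complex_of_real c * signed_integral \<nu> f"
proof -
  obtain S g where d: "has_density \<nu> S g"
    using fs by (auto simp: finite_signed_def)
  note d' = has_density_cmult[OF d, of c]
  note int = signed_integral_has_density[OF d f] signed_integral_has_density[OF d' f]
  have s: "(c * g t) *\<^sub>R f t = c *\<^sub>R (g t *\<^sub>R f t)" for t by simp
  show "finite_signed (\<lambda>A. c * \<nu> A)" using d' by (auto simp: finite_signed_def)
  show *: "signed_integrable (\<lambda>A. c * \<nu> A) f"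
    using i unfolding int s by (intro integrable_scaleR_right) simp
  show "signed_integral (\<lambda>A. c * \<nu> A) f = complex_of_real c * signed_integral \<nu> f"
    unfolding int(2)[OF i] int(4)[OF *] s integral_scaleR_right by (simp add: scaleR_conv_of_real)
qed

lemma signed_integral_linear:
  assumes fs: "finite_signed \<nu>"
    and f: "f \<in> borel_measurable borel" "signed_integrable \<nu> f"
    and g: "g \<in> borel_measurable borel" "signed_integrable \<nu> g"
  shows "signed_integrable \<nu> (\<lambda>t. f t + z * g t)"
    "signed_integral \<nu> (\<lambda>t. f t + z * g t) = signed_integral \<nu> f + z * signed_integral \<nu> g"
proof -
  have f': "integrable (upper_variation \<nu>) f" "integrable (upper_variation (\<lambda>A. - \<nu> A)) f"
    using f by (auto simp: signed_integrable_def)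
  have g': "integrable (upper_variation \<nu>) g" "integrable (upper_variation (\<lambda>A. - \<nu> A)) g"
    using g by (auto simp: signed_integrable_def)
  show "signed_integrable \<nu> (\<lambda>t. f t + z * g t)"
    using f' g' by (auto simp: signed_integrable_def)
  show "signed_integral \<nu> (\<lambda>t. f t + z * g t) = signed_integral \<nu> f + z * signed_integral \<nu> g"
    using f' g' by (simp add: signed_integral_def algebra_simps)
qed

lemma signed_integral_measure:
  assumes M: "finite_measure M" "sets M = sets borel" and f: "f \<in> borel_measurable borel"
  shows "finite_signed (measure M)"
    "signed_integrable (measure M) f \<longleftrightarrow> integrable M f"
    "signed_integrable (measure M) f \<Longrightarrow> signed_integral (measure M) f = (LINT t|M. f t)"
proof -
  interpret finite_measure M by fact
  have d: "has_density (measure M) M (\<lambda>_. 1)"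
    using M by (auto simp: has_density_def set_lebesgue_integral_def)
  then show "finite_signed (measure M)" by (auto simp: finite_signed_def)
  show "signed_integrable (measure M) f \<longleftrightarrow> integrable M f"
    "signed_integrable (measure M) f \<Longrightarrow> signed_integral (measure M) f = (LINT t|M. f t)"
    using signed_integral_has_density[OF d f] by auto
qed


lemma finite_signed_sums:
  assumes "finite_signed \<nu>" "range A \<subseteq> sets borel" "disjoint_family (A :: nat \<Rightarrow> real set)"
  shows "(\<lambda>n. \<nu> (A n)) sums \<nu> (\<Union>n. A n)"
proof -
  obtain P N where PN: "finite_measure P" "finite_measure N" "sets P = sets borel" "sets N = sets borel"
    "\<And>A. A \<in> sets borel \<Longrightarrow> \<nu> A = measure P A - measure N A"
    using finite_signed_decomposition[OF assms(1)] by blast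
  have "(\<lambda>n. measure P (A n) - measure N (A n)) sums (measure P (\<Union>n. A n) - measure N (\<Union>n. A n))"
    using PN assms by (intro sums_diff finite_measure.finite_measure_UNION) auto
  moreover have "\<And>n. A n \<in> sets borel" "(\<Union>n. A n) \<in> sets borel"
    using assms(2) by auto
  ultimately show ?thesis by (simp add: PN(5))
qed


section \<open>Complex measures and positive semidefinite matrix measures\<close>

lemma finite_signed_add: "finite_signed \<nu>1 \<Longrightarrow> finite_signed \<nu>2 \<Longrightarrow> finite_signed (\<lambda>A. \<nu>1 A + \<nu>2 A)"
  using signed_integrable_add(1)[of \<nu>1 \<nu>2 "\<lambda>_. 0"] by (simp add: signed_integrable_def)

lemma finite_signed_cmult: "finite_signed \<nu> \<Longrightarrow> finite_signed (\<lambda>A. c * \<nu> A)"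
  using signed_integrable_cmult(1)[of \<nu> "\<lambda>_. 0"] by (simp add: signed_integrable_def)

lemma signed_integral_uminus: "signed_integral (\<lambda>A. - \<nu> A) f = - signed_integral \<nu> f"
  by (simp add: signed_integral_def)

lemma signed_integral_zero [simp]: "signed_integral (\<lambda>A. 0) f = 0"
  by (simp add: signed_integral_def)

lemma zero_signed_measure:
  assumes "f \<in> borel_measurable borel"
  shows "finite_signed (\<lambda>A. 0)" "signed_integrable (\<lambda>A. 0) f"
proof -
  have 0: "has_density (\<lambda>A. 0) borel (\<lambda>_. 0)"
    by (simp add: has_density_def)
  then show "finite_signed (\<lambda>A. 0)" "signed_integrable (\<lambda>A. 0) f"
    using signed_integral_has_density(1)[OF 0] assms by (auto simp: finite_signed_def)
qed

text \<open>
  Finite complex Borel measures, given as set functions.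
\<close>

definition finite_cmeasure :: "(real set \<Rightarrow> complex) \<Rightarrow> bool" where
  "finite_cmeasure \<nu> \<longleftrightarrow> finite_signed (\<lambda>A. Re (\<nu> A)) \<and> finite_signed (\<lambda>A. Im (\<nu> A))"

lemma cmeasure_add:
  assumes "finite_cmeasure \<nu>1" "finite_cmeasure \<nu>2" "f \<in> borel_measurable borel"
    "cmeasure_integrable \<nu>1 f" "cmeasure_integrable \<nu>2 f"
  shows "cmeasure_integrable (\<lambda>A. \<nu>1 A + \<nu>2 A) f"
    "cmeasure_integral (\<lambda>A. \<nu>1 A + \<nu>2 A) f = cmeasure_integral \<nu>1 f + cmeasure_integral \<nu>2 f"
  using assms signed_integrable_add[of "\<lambda>A. Re (\<nu>1 A)" "\<lambda>A. Re (\<nu>2 A)" f]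
    signed_integrable_add[of "\<lambda>A. Im (\<nu>1 A)" "\<lambda>A. Im (\<nu>2 A)" f]
  by (auto simp: finite_cmeasure_def cmeasure_integrable_def cmeasure_integral_def algebra_simps)

lemma finite_cmeasure_add:
  "finite_cmeasure \<nu>1 \<Longrightarrow> finite_cmeasure \<nu>2 \<Longrightarrow> finite_cmeasure (\<lambda>A. \<nu>1 A + \<nu>2 A)"
  by (auto simp: finite_cmeasure_def intro: finite_signed_add)

lemma finite_cmeasure_cmult:
  assumes "finite_cmeasure \<nu>" shows "finite_cmeasure (\<lambda>A. z * \<nu> A)"
proof -
  have "finite_signed (\<lambda>A. Re z * Re (\<nu> A) + - Im z * Im (\<nu> A))"
    "finite_signed (\<lambda>A. Re z * Im (\<nu> A) + Im z * Re (\<nu> A))"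
    using assms unfolding finite_cmeasure_def by (metis finite_signed_add finite_signed_cmult)+
  then show ?thesis by (simp add: finite_cmeasure_def)
qed

lemma cmeasure_cmult:
  assumes fs: "finite_cmeasure \<nu>" and f: "f \<in> borel_measurable borel" and i: "cmeasure_integrable \<nu> f"
  shows "cmeasure_integrable (\<lambda>A. z * \<nu> A) f"
    "cmeasure_integral (\<lambda>A. z * \<nu> A) f = z * cmeasure_integral \<nu> f"
proof -
  have s: "finite_signed (\<lambda>A. Re (\<nu> A))" "finite_signed (\<lambda>A. Im (\<nu> A))"
    "signed_integrable (\<lambda>A. Re (\<nu> A)) f" "signed_integrable (\<lambda>A. Im (\<nu> A)) f"
    using fs i by (auto simp: finite_cmeasure_def cmeasure_integrable_def)
  note c = signed_integrable_cmult[OF s(1) f s(3)] signed_integrable_cmult[OF s(2) f s(4)]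
  note re = signed_integrable_add[OF c(1) c(4) f c(2) c(5), of "Re z" "- Im z"]
  note im = signed_integrable_add[OF c(4) c(1) f c(5) c(2), of "Re z" "Im z"]
  show "cmeasure_integrable (\<lambda>A. z * \<nu> A) f"
    using re(2) im(2) by (simp add: cmeasure_integrable_def)
  have z: "z = complex_of_real (Re z) + \<i> * complex_of_real (Im z)" by (rule complex_eq)
  have "cmeasure_integral (\<lambda>A. z * \<nu> A) f =
     (complex_of_real (Re z) + \<i> * complex_of_real (Im z)) * cmeasure_integral \<nu> f"
    using re(3) im(3) c(3,6) signed_integrable_cmult(3)[OF s(2) f s(4), of "- Im z"]
    unfolding cmeasure_integral_def by (simp add: algebra_simps)
  then show "cmeasure_integral (\<lambda>A. z * \<nu> A) f = z * cmeasure_integral \<nu> f"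
    using z by simp
qed

lemma cmeasure_sum:
  assumes "finite I" "\<And>i. i \<in> I \<Longrightarrow> finite_cmeasure (\<nu> i)" "f \<in> borel_measurable borel"
    "\<And>i. i \<in> I \<Longrightarrow> cmeasure_integrable (\<nu> i) f"
  shows "finite_cmeasure (\<lambda>A. \<Sum>i\<in>I. \<nu> i A)" "cmeasure_integrable (\<lambda>A. \<Sum>i\<in>I. \<nu> i A) f"
    "cmeasure_integral (\<lambda>A. \<Sum>i\<in>I. \<nu> i A) f = (\<Sum>i\<in>I. cmeasure_integral (\<nu> i) f)"
proof -
  note 1 = zero_signed_measure[OF assms(3)]
  have "finite_cmeasure (\<lambda>A. \<Sum>i\<in>I. \<nu> i A) \<and> cmeasure_integrable (\<lambda>A. \<Sum>i\<in>I. \<nu> i A) f \<and>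
    cmeasure_integral (\<lambda>A. \<Sum>i\<in>I. \<nu> i A) f = (\<Sum>i\<in>I. cmeasure_integral (\<nu> i) f)"
    using assms(1,2,4)
  proof (induction I)
    case empty
    then show ?case using 1
      by (simp add: finite_cmeasure_def cmeasure_integrable_def cmeasure_integral_def)
  next
    case (insert i I)
    then show ?case
      using cmeasure_add[of "\<nu> i" "\<lambda>A. \<Sum>i\<in>I. \<nu> i A" f] finite_cmeasure_add[of "\<nu> i" "\<lambda>A. \<Sum>i\<in>I. \<nu> i A"]
        assms(3) by simp
  qed
  then show "finite_cmeasure (\<lambda>A. \<Sum>i\<in>I. \<nu> i A)" "cmeasure_integrable (\<lambda>A. \<Sum>i\<in>I. \<nu> i A) f"
    "cmeasure_integral (\<lambda>A. \<Sum>i\<in>I. \<nu> i A) f = (\<Sum>i\<in>I. cmeasure_integral (\<nu> i) f)"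
    by auto
qed

lemma cmeasure_integral_linear:
  assumes fs: "finite_cmeasure \<nu>"
    and f: "f \<in> borel_measurable borel" "cmeasure_integrable \<nu> f"
    and g: "g \<in> borel_measurable borel" "cmeasure_integrable \<nu> g"
  shows "cmeasure_integrable \<nu> (\<lambda>t. f t + z * g t)"
    "cmeasure_integral \<nu> (\<lambda>t. f t + z * g t) = cmeasure_integral \<nu> f + z * cmeasure_integral \<nu> g"
proof -
  have s: "finite_signed (\<lambda>A. Re (\<nu> A))" "finite_signed (\<lambda>A. Im (\<nu> A))"
    "signed_integrable (\<lambda>A. Re (\<nu> A)) f" "signed_integrable (\<lambda>A. Im (\<nu> A)) f"
    "signed_integrable (\<lambda>A. Re (\<nu> A)) g" "signed_integrable (\<lambda>A. Im (\<nu> A)) g"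
    using fs f g by (auto simp: finite_cmeasure_def cmeasure_integrable_def)
  note l = signed_integral_linear[OF s(1) f(1) s(3) g(1) s(5), of z]
    signed_integral_linear[OF s(2) f(1) s(4) g(1) s(6), of z]
  show "cmeasure_integrable \<nu> (\<lambda>t. f t + z * g t)"
    using l by (simp add: cmeasure_integrable_def)
  show "cmeasure_integral \<nu> (\<lambda>t. f t + z * g t) = cmeasure_integral \<nu> f + z * cmeasure_integral \<nu> g"
    using l by (simp add: cmeasure_integral_def algebra_simps)
qed

lemma cmeasure_of_measure:
  assumes M: "finite_measure M" "sets M = sets borel" and f: "f \<in> borel_measurable borel"
  defines "\<nu> \<equiv> \<lambda>A. complex_of_real (measure M A)"
  shows "finite_cmeasure \<nu>" "cmeasure_integrable \<nu> f \<longleftrightarrow> integrable M f"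
    "cmeasure_integrable \<nu> f \<Longrightarrow> cmeasure_integral \<nu> f = (LINT t|M. f t)"
proof -
  note 1 = zero_signed_measure[OF f]
  show "finite_cmeasure \<nu>" "cmeasure_integrable \<nu> f \<longleftrightarrow> integrable M f"
    "cmeasure_integrable \<nu> f \<Longrightarrow> cmeasure_integral \<nu> f = (LINT t|M. f t)"
    using signed_integral_measure[OF M f] 1
    by (auto simp: \<nu>_def finite_cmeasure_def cmeasure_integrable_def cmeasure_integral_def)
qed

text \<open>
  Matrices of measures with positive semidefinite values; no condition on moments is imposed.
\<close>

definition psd_measure :: "'n::finite matrix_measure \<Rightarrow> bool" where
  "psd_measure W \<longleftrightarrow> is_matrix_measure W \<and> (\<forall>\<Omega>\<in>sets borel. pos_semidef (W \<Omega>))"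

text \<open>
  The scalar measure \<open>v\<^sup>* W v\<close> as a complex-valued set function.  It is a positive measure if \<open>W\<close> takes
  positive semidefinite values.
\<close>

definition quad_form :: "'n::finite matrix_measure \<Rightarrow> complex^'n \<Rightarrow> real set \<Rightarrow> complex" where
  "quad_form W v A = (\<Sum>i\<in>UNIV. \<Sum>j\<in>UNIV. cnj (v $ i) * v $ j * W A $ i $ j)"

lemma psd_measure_hermitian:
  assumes "psd_measure W" shows "W A $ j $ i = cnj (W A $ i $ j)"
proof (cases "A \<in> sets borel")
  case True
  then have "conj_transpose (W A) = W A" using assms by (auto simp: psd_measure_def pos_semidef_def)
  then have "conj_transpose (W A) $ j $ i = W A $ j $ i" by simp
  then show ?thesis by (simp add: conj_transpose_def)
next
  case False
  then show ?thesis using assms by (auto simp: psd_measure_def is_matrix_measure_def)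
qed

lemma psd_measure_quad_form:
  assumes W: "psd_measure W"
  obtains M where "finite_measure M" "sets M = sets borel"
    "quad_form W v = (\<lambda>A. complex_of_real (measure M A))"
proof -
  have im: "Im (quad_form W v A) = 0" for A
  proof -
    have "cnj (quad_form W v A) = (\<Sum>i\<in>UNIV. \<Sum>j\<in>UNIV. cnj (v $ j) * v $ i * W A $ j $ i)"
      by (simp add: quad_form_def psd_measure_hermitian[OF W, symmetric] mult_ac)
    also have "\<dots> = quad_form W v A"
      unfolding quad_form_def by (rule sum.swap)
    finally show ?thesis by (metis Reals_cnj_iff complex_is_Real_iff)
  qed
  have 1: "0 \<le> Re (quad_form W v A)" if "A \<in> sets borel" for A
    using W that unfolding psd_measure_def pos_semidef_def quad_form_def by (auto simp: mult_ac)
  have 2: "(\<lambda>n. Re (quad_form W v (A n))) sums Re (quad_form W v (\<Union>n. A n))"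
    if "range A \<subseteq> sets borel" "disjoint_family A" for A :: "nat \<Rightarrow> real set"
  proof -
    have "(\<lambda>n. W (A n)) sums W (\<Union>n. A n)"
      using W that by (auto simp: psd_measure_def is_matrix_measure_def)
    then have "(\<lambda>n. W (A n) $ i $ j) sums W (\<Union>n. A n) $ i $ j" for i j
      by (intro sums_vec_nth)
    then have "(\<lambda>n. quad_form W v (A n)) sums quad_form W v (\<Union>n. A n)"
      unfolding quad_form_def by (intro sums_sum sums_mult)
    then show ?thesis by (rule sums_Re)
  qed
  obtain M where M: "finite_measure M" "sets M = sets borel"
    "\<And>A. A \<in> sets borel \<Longrightarrow> measure M A = Re (quad_form W v A)"
    using finite_measure_of_set_function[OF 1 2] by blast
  have "quad_form W v A = complex_of_real (measure M A)" for A
  proof (cases "A \<in> sets borel")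
    case True
    then show ?thesis using M(3)[OF True] im by (simp add: complex_eq_iff)
  next
    case False
    then show ?thesis using M(2) W
      by (simp add: measure_notin_sets psd_measure_def is_matrix_measure_def quad_form_def)
  qed
  then show thesis using M(1,2) that by blast
qed

lemma quad_form_axis:
  fixes W :: "'n::finite matrix_measure"
  shows "quad_form W (axis k 1 + axis l z) A =
     W A $ k $ k + z * W A $ k $ l + cnj z * W A $ l $ k + cnj z * z * W A $ l $ l"
proof -
  have a: "(axis k c :: complex^'n) $ i = (if i = k then c else 0)" for k i :: 'n and c
    by (simp add: axis_def)
  have c: "cnj (if b then x else 0) = (if b then cnj x else 0)" for b x by simp
  show ?thesis
    unfolding quad_form_def
    by (simp add: a c distrib_left distrib_right sum.distrib if_distrib[of "\<lambda>x. x * _"] 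
      if_distrib[of "\<lambda>x. _ * x"] sum.delta cong: if_cong)
qed

text \<open>
  The coefficients arise from the vectors \<open>e\<^sub>k + e\<^sub>l\<close>, \<open>e\<^sub>k + \<i> e\<^sub>l\<close>, \<open>e\<^sub>k\<close> and \<open>e\<^sub>l\<close>; the formula holds for
  \<open>k = l\<close> as well.
\<close>

lemma psd_measure_polarization:
  assumes W: "psd_measure W"
  shows "W A $ k $ l = (1/2) * (quad_form W (axis k 1 + axis l 1) A +
      (-\<i>) * quad_form W (axis k 1 + axis l \<i>) A +
      (\<i> - 1) * (quad_form W (axis k 1 + axis l 0) A + quad_form W (axis l 1 + axis l 0) A))"
  unfolding quad_form_axis by (simp add: algebra_simps)

lemma psd_measure_eqI:
  assumes "psd_measure W" "psd_measure V" "\<And>v A. A \<in> sets borel \<Longrightarrow> quad_form W v A = quad_form V v A"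
  shows "W = V"
proof
  fix A
  show "W A = V A"
  proof (cases "A \<in> sets borel")
    case True
    have "W A $ k $ l = V A $ k $ l" for k l
      unfolding psd_measure_polarization[OF assms(1)] psd_measure_polarization[OF assms(2)] assms(3)[OF True] ..
    then show ?thesis by (simp add: vec_eq_iff)
  next
    case False
    then show ?thesis using assms by (simp add: psd_measure_def is_matrix_measure_def)
  qed
qed

lemma psd_measure_finite_cmeasure:
  assumes W: "psd_measure W" shows "finite_cmeasure (\<lambda>A. W A $ k $ l)"
proof -
  have q: "finite_cmeasure (quad_form W v)" for v
    using psd_measure_quad_form[OF W, of v] cmeasure_of_measure(1)[of _ "\<lambda>_. 0"]
    by (metis borel_measurable_const)
  show ?thesis
    by (subst psd_measure_polarization[OF W], intro finite_cmeasure_cmult finite_cmeasure_add q)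
qed

lemma quad_form_integral:
  assumes W: "psd_measure W" and f: "f \<in> borel_measurable borel"
    and i: "\<And>k l. cmeasure_integrable (\<lambda>A. W A $ k $ l) f"
  shows "cmeasure_integrable (quad_form W v) f"
    "cmeasure_integral (quad_form W v) f =
      (\<Sum>i\<in>UNIV. \<Sum>j\<in>UNIV. cnj (v $ i) * v $ j * cmeasure_integral (\<lambda>A. W A $ i $ j) f)"
proof -
  note fc = psd_measure_finite_cmeasure[OF W]
  note m = cmeasure_cmult[OF fc f i] finite_cmeasure_cmult[OF fc]
  have s: "finite_cmeasure (\<lambda>A. \<Sum>j\<in>UNIV. cnj (v $ i) * v $ j * W A $ i $ j)"
    "cmeasure_integrable (\<lambda>A. \<Sum>j\<in>UNIV. cnj (v $ i) * v $ j * W A $ i $ j) f"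
    "cmeasure_integral (\<lambda>A. \<Sum>j\<in>UNIV. cnj (v $ i) * v $ j * W A $ i $ j) f =
      (\<Sum>j\<in>UNIV. cnj (v $ i) * v $ j * cmeasure_integral (\<lambda>A. W A $ i $ j) f)" for i
    using m f by (simp_all add: cmeasure_sum)
  have e: "quad_form W v = (\<lambda>A. \<Sum>i\<in>UNIV. \<Sum>j\<in>UNIV. cnj (v $ i) * v $ j * W A $ i $ j)"
    by (simp add: quad_form_def fun_eq_iff)
  show "cmeasure_integrable (quad_form W v) f"
    "cmeasure_integral (quad_form W v) f =
      (\<Sum>i\<in>UNIV. \<Sum>j\<in>UNIV. cnj (v $ i) * v $ j * cmeasure_integral (\<lambda>A. W A $ i $ j) f)"
    unfolding e using s f cmeasure_sum[of UNIV "\<lambda>i A. \<Sum>j\<in>UNIV. cnj (v $ i) * v $ j * W A $ i $ j" f]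
    by simp_all
qed


section \<open>Determinacy of the moment problem under exponential integrability\<close>

text \<open>
  Since \<open>cosh (c t)\<close> is a power series in even powers of \<open>t\<close> with nonnegative terms, its integral is
  determined by the moments.
\<close>

lemma integrable_cosh_moments:
  fixes M N :: "real measure"
  assumes fin: "finite_measure M" "finite_measure N" and s: "sets M = sets borel" "sets N = sets borel"
    and iM: "\<And>n. integrable M (\<lambda>t. t ^ n)" and iN: "\<And>n. integrable N (\<lambda>t. t ^ n)"
    and eq: "\<And>n. (LINT t|M. t ^ n) = (LINT t|N. t ^ n)"
    and c: "integrable N (\<lambda>t. cosh (c * t))"
  shows "integrable M (\<lambda>t. cosh (c * t))"
proof -
  define f where "f n t = (if even n then (c * t) ^ n /\<^sub>R fact n else 0)" for n and t :: real
  have f0: "0 \<le> f n t" for n t by (auto simp: f_def intro!: divide_nonneg_nonneg zero_le_even_power)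
  have fs: "(\<Sum>n. ennreal (f n t)) = ennreal (cosh (c * t))" for t
    using cosh_converges[of "c * t"] f0 unfolding f_def[symmetric] by (intro suminf_ennreal_eq) auto
  have f': "f n = (\<lambda>t. (if even n then c ^ n / fact n else 0) * t ^ n)" for n
    by (auto simp: f_def fun_eq_iff power_mult_distrib divide_simps)
  have fi: "integrable M (f n)" "integrable N (f n)" "(LINT t|M. f n t) = (LINT t|N. f n t)" for n
    unfolding f' using iM iN eq by auto
  have [measurable]: "f n \<in> borel_measurable M" "f n \<in> borel_measurable N" for n
    using fi by auto
  have "(\<integral>\<^sup>+t. ennreal (cosh (c * t)) \<partial>M) = (\<Sum>n. \<integral>\<^sup>+t. ennreal (f n t) \<partial>M)"
    unfolding fs[symmetric] by (intro nn_integral_suminf) auto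
  also have "\<dots> = (\<Sum>n. \<integral>\<^sup>+t. ennreal (f n t) \<partial>N)"
    using fi f0 by (subst (1 2) nn_integral_eq_integral) auto
  also have "\<dots> = (\<integral>\<^sup>+t. ennreal (cosh (c * t)) \<partial>N)"
    unfolding fs[symmetric] by (intro nn_integral_suminf[symmetric]) auto
  also have "\<dots> < \<infinity>" using c by (simp add: nn_integral_eq_integral)
  finally have fin: "(\<integral>\<^sup>+t. ennreal (cosh (c * t)) \<partial>M) < \<infinity>" .
  have "(\<lambda>t. cosh (c * t)) \<in> borel_measurable borel"
    by (intro borel_measurable_continuous_onI continuous_intros)
  then show ?thesis
    using s(1) fin by (intro integrableI_nonneg) (auto cong: measurable_cong_sets)
qed

lemma char_eq_suminf_moments:
  fixes M :: "real measure"
  assumes s: "sets M = sets borel" and iM: "\<And>n. integrable M (\<lambda>t. t ^ n)"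
    and c: "integrable M (\<lambda>t. cosh (x * t))"
  shows "char M x = (\<Sum>n. (\<i> * x) ^ n / fact n * complex_of_real (LINT t|M. t ^ n))"
proof -
  define f where "f n t = (\<i> * complex_of_real (x * t)) ^ n /\<^sub>R fact n" for n t
  have f': "f n = (\<lambda>t. ((\<i> * x) ^ n / fact n) * complex_of_real (t ^ n))" for n
    by (simp add: f_def fun_eq_iff power_mult_distrib scaleR_conv_of_real divide_simps)
  have fi: "integrable M (f n)" for n
    unfolding f' using iM[of n] by (intro integrable_mult_right integrable_of_real)
  have nf: "norm (f n t) = \<bar>x * t\<bar> ^ n /\<^sub>R fact n" for n t
    unfolding f_def norm_scaleR norm_power norm_mult norm_of_real by (simp add: norm_ii)
  have ns: "(\<lambda>n. norm (f n t)) sums exp \<bar>x * t\<bar>" for t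
    unfolding nf by (rule exp_converges)
  have cosh: "exp \<bar>x * t\<bar> \<le> 2 * cosh (x * t)" for t
    by (auto simp: cosh_def abs_if)
  have "summable (\<lambda>n. LINT t|M. norm (f n t))"
  proof (rule summableI_nonneg_bounded)
    show "0 \<le> (LINT t|M. norm (f n t))" for n by simp
    show "(\<Sum>i<n. LINT t|M. norm (f i t)) \<le> (LINT t|M. 2 * cosh (x * t))" for n
    proof -
      have "(\<Sum>i<n. LINT t|M. norm (f i t)) = (LINT t|M. (\<Sum>i<n. norm (f i t)))"
        using fi by (subst Bochner_Integration.integral_sum) auto
      also have "\<dots> \<le> (LINT t|M. 2 * cosh (x * t))"
      proof (rule integral_mono)
        show "(\<Sum>i<n. norm (f i t)) \<le> 2 * cosh (x * t)" for t
          using sum_le_suminf[of "\<lambda>n. norm (f n t)" "{..<n}"] ns[of t] cosh[of t]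
          by (auto simp: sums_iff)
      qed (use fi c in auto)
      finally show ?thesis .
    qed
  qed
  then have "(\<Sum>n. LINT t|M. f n t) = (LINT t|M. (\<Sum>n. f n t))"
    using fi ns by (intro integral_suminf[symmetric]) (auto simp: sums_iff)
  also have "(\<lambda>t. \<Sum>n. f n t) = (\<lambda>t. iexp (x * t))"
    unfolding f_def exp_def by simp
  finally have "char M x = (\<Sum>n. LINT t|M. f n t)"
    by (simp add: char_def)
  also have "(\<lambda>n. LINT t|M. f n t) = (\<lambda>n. (\<i> * x) ^ n / fact n * complex_of_real (LINT t|M. t ^ n))"
    unfolding f' by (simp only: integral_mult_right_zero integral_complex_of_real)
  finally show ?thesis .
qed

lemma finite_measure_eqI_char:
  fixes M N :: "real measure"
  assumes fin: "finite_measure M" "finite_measure N" and s: "sets M = sets borel" "sets N = sets borel"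
    and eq: "\<And>x. char M x = char N x"
  shows "M = N"
proof -
  interpret M: finite_measure M by fact
  interpret N: finite_measure N by fact
  have sp: "space M = UNIV" "space N = UNIV"
    using s[THEN sets_eq_imp_space_eq] by auto
  have m: "measure M UNIV = measure N UNIV"
    using eq[of 0] sp by (simp add: char_def)
  show ?thesis
  proof (cases "measure M UNIV = 0")
    case True
    have "emeasure M A = emeasure N A" for A
      using True m sp M.bounded_measure[of A] N.bounded_measure[of A]
      by (simp add: M.emeasure_eq_measure N.emeasure_eq_measure measure_le_0_iff)
    then show ?thesis using s by (intro measure_eqI) auto
  next
    case False
    define c where "c = 1 / measure M UNIV"
    have c: "c > 0" using False by (simp add: c_def zero_less_measure_iff)
    let ?d = "\<lambda>M. density M (\<lambda>_. ennreal c)"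
    have rd: "real_distribution (?d K)" if "finite_measure K" "sets K = sets borel"
      "measure K UNIV = measure M UNIV" for K :: "real measure"
    proof -
      interpret finite_measure K by fact
      have spK: "space K = UNIV" using that(2)[THEN sets_eq_imp_space_eq] by simp
      have "emeasure (?d K) UNIV = ennreal c * emeasure K UNIV"
        using spK sets.top[of K] by (subst emeasure_density) (auto simp: nn_integral_cmult)
      also have "\<dots> = ennreal (c * measure M UNIV)"
        using that(3) c by (simp add: emeasure_eq_measure ennreal_mult)
      also have "\<dots> = 1" using False by (simp add: c_def)
      finally have "prob_space (?d K)" using spK by (intro prob_spaceI) simp
      then show ?thesis using that spK by (simp add: real_distribution_def real_distribution_axioms_def)
    qed
    have ch: "char (?d K) x = c *\<^sub>R char K x" if "sets K = sets borel" for K :: "real measure" and x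
      unfolding char_def using that c
      by (subst integral_density) (auto cong: measurable_cong_sets)
    have "char (?d M) = char (?d N)"
      by (rule ext) (simp only: ch[OF s(1)] ch[OF s(2)] eq)
    then have "?d M = ?d N"
      by (rule Levy_uniqueness[OF rd[OF fin(1) s(1) refl] rd[OF fin(2) s(2) m[symmetric]]])
    have "emeasure M A = emeasure N A" if A: "A \<in> sets M" for A
    proof -
      have "ennreal c * emeasure M A = emeasure (?d M) A"
        using A by (subst emeasure_density) (auto simp: nn_integral_cmult)
      also have "\<dots> = ennreal c * emeasure N A"
        unfolding \<open>?d M = ?d N\<close> using A s by (subst emeasure_density) (auto simp: nn_integral_cmult)
      finally show ?thesis using c by (simp add: ennreal_mult_cancel_left)
    qed
    then show ?thesis using s by (intro measure_eqI) auto
  qed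
qed

text \<open>
  Only one of the two measures is assumed to integrate exponentials: the other one then does so by
  equality of the even moments.
\<close>

theorem finite_measure_eqI_moments:
  fixes M N :: "real measure"
  assumes fin: "finite_measure M" "finite_measure N" and s: "sets M = sets borel" "sets N = sets borel"
    and iM: "\<And>n. integrable M (\<lambda>t. t ^ n)" and iN: "\<And>n. integrable N (\<lambda>t. t ^ n)"
    and eq: "\<And>n. (LINT t|M. t ^ n) = (LINT t|N. t ^ n)"
    and ex: "\<And>c. integrable N (\<lambda>t. exp (c * t))"
  shows "M = N"
proof (rule finite_measure_eqI_char[OF fin s])
  fix x
  have N: "integrable N (\<lambda>t. cosh (x * t))"
    using ex[of x] ex[of "- x"] by (simp add: cosh_def)
  note M = integrable_cosh_moments[OF fin s iM iN eq N]
  show "char M x = char N x"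
    using char_eq_suminf_moments[OF s(1) iM M] char_eq_suminf_moments[OF s(2) iN N] eq by simp
qed


section \<open>Symmetry as moment equations\<close>

text \<open>
  Linear functionals on complex polynomials.
\<close>

definition poly_functional :: "(complex poly \<Rightarrow> complex) \<Rightarrow> bool" where
  "poly_functional L \<longleftrightarrow> (\<forall>p q. L (p + q) = L p + L q) \<and> (\<forall>c p. L (smult c p) = c * L p)"

lemma poly_functionalD:
  assumes "poly_functional L"
  shows "L (p + q) = L p + L q" "L (smult c p) = c * L p" "L 0 = 0" "L (- p) = - L p" "L (p - q) = L p - L q"
proof -
  show a: "L (p + q) = L p + L q" and s: "L (smult c p) = c * L p" for p q c
    using assms by (auto simp: poly_functional_def)
  show "L 0 = 0" using s[of 0 0] by simp
  show m: "L (- p) = - L p" for p using s[of "-1" p] by simp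
  show "L (p - q) = L p - L q" using a[of p "- q"] m by simp
qed

lemma poly_functional_sum:
  assumes "poly_functional L" shows "L (\<Sum>i\<in>I. p i) = (\<Sum>i\<in>I. L (p i))"
  by (induction I rule: infinite_finite_induct) (auto simp: poly_functionalD[OF assms])

text \<open>
  The scalar core of the passage from symmetry to differential equations.  With \<open>g = 1\<close> the symmetry gives
  the third equation; subtracting its instance at \<open>f g\<close> and taking \<open>g = t\<close> and \<open>g = t\<^sup>2\<close> gives the other two.
\<close>

lemma moment_equations_iff:
  assumes lin: "poly_functional A" "poly_functional B" "poly_functional C"
    "poly_functional A'" "poly_functional B'" "poly_functional C'"
  shows "(\<forall>f g. A (pderiv (pderiv f) * g) + B (pderiv f * g) + C (f * g) =
                A' (f * pderiv (pderiv g)) + B' (f * pderiv g) + C' (f * g)) \<longleftrightarrow>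
    (\<forall>f. A f = A' f) \<and> (\<forall>f. 2 * A (pderiv f) + B f + B' f = 0) \<and>
    (\<forall>f. A (pderiv (pderiv f)) + B (pderiv f) + C f = C' f)" (is "?sym \<longleftrightarrow> ?eqs")
proof -
  note l = lin[THEN poly_functionalD(1)] lin[THEN poly_functionalD(3)]
  have t: "A (p * (q * 2)) = 2 * A (p * q)" for p q
  proof -
    have "p * (q * 2) = p * q + p * q" by simp
    then show ?thesis by (simp only: l) simp
  qed
  show ?thesis
  proof
    assume s: ?sym
    have e3: "A (pderiv (pderiv f)) + B (pderiv f) + C f = C' f" for f
      using s[rule_format, of f 1] by (simp add: l pderiv_1)
    have k: "A (f * pderiv (pderiv g)) + A' (f * pderiv (pderiv g)) +
       (B (f * pderiv g) + B' (f * pderiv g)) + 2 * A (pderiv f * pderiv g) = 0" for f g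
    proof -
      have "A (f * pderiv (pderiv g)) + 2 * A (pderiv f * pderiv g) + A (pderiv (pderiv f) * g) +
          (B (pderiv f * g) + B (f * pderiv g)) + C (f * g) = C' (f * g)"
        using e3[of "f * g"] by (simp add: pderiv_mult pderiv_add l algebra_simps t)
      moreover have "a2 + a' + (b2 + b') + 2 * k = 0"
        if "a2 + 2 * k + a + (b + b2) + c = c'" "a + b + c = a' + b' + c'"
        for a a2 a' b b2 b' c c' k :: complex
      proof -
        have "a2 + a' + (b2 + b') + 2 * k = (a2 + 2 * k + a + (b + b2) + c) - (a + b + c) + a' + b'"
          by simp
        then show ?thesis unfolding that by simp
      qed
      ultimately show ?thesis using s[rule_format, of f g] by blast
    qed
    have e2: "2 * A (pderiv f) + B f + B' f = 0" for f
      using k[of f "[:0, 1:]"] by (simp add: pderiv_pCons l algebra_simps)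
    have "A f = A' f" for f
    proof -
      have "pderiv [:0, 0, 1:] = [:0, 2::complex:]" "pderiv [:0, 2::complex:] = [:2:]"
        by (simp_all add: pderiv_pCons)
      then have k2: "2 * A f + 2 * A' f + (B (f * [:0, 2:]) + B' (f * [:0, 2:])) + 2 * A (pderiv f * [:0, 2:]) = 0"
        using k[of f "[:0, 0, 1:]"]
        by (simp only: mult_pCons_right[of f 2 0] mult_zero_right l poly_functionalD(2)[OF lin(1)]
            poly_functionalD(2)[OF lin(4)] pCons_0_0 add_0_right)
      have "pderiv (f * [:0, 2:]) = pderiv f * [:0, 2:] + smult 2 f"
        unfolding pderiv_mult by (simp add: pderiv_pCons)
      then have "2 * (A (pderiv f * [:0, 2:]) + 2 * A f) + B (f * [:0, 2:]) + B' (f * [:0, 2:]) = 0"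
        using e2[of "f * [:0, 2:]"] by (simp only: l poly_functionalD(2)[OF lin(1)])
      then have "(2 * A f + 2 * A' f + (B (f * [:0, 2:]) + B' (f * [:0, 2:])) + 2 * A (pderiv f * [:0, 2:])) -
         (2 * (A (pderiv f * [:0, 2:]) + 2 * A f) + B (f * [:0, 2:]) + B' (f * [:0, 2:])) = 0"
        using k2 by simp
      then show ?thesis by (simp add: algebra_simps)
    qed
    then show ?eqs using e2 e3 by blast
  next
    assume e: ?eqs
    show ?sym
    proof (intro allI)
      fix f g
      have 1: "A p = A' p" for p using e by blast
      have 2: "2 * A (pderiv (f * pderiv g)) + B (f * pderiv g) + B' (f * pderiv g) = 0"
        using e by blast
      have 3: "A (pderiv (pderiv (f * g))) + B (pderiv (f * g)) + C (f * g) = C' (f * g)"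
        using e by blast
      show "A (pderiv (pderiv f) * g) + B (pderiv f * g) + C (f * g) =
                A' (f * pderiv (pderiv g)) + B' (f * pderiv g) + C' (f * g)"
      proof -
        have "A (f * pderiv (pderiv g)) + 2 * A (pderiv f * pderiv g) + A (pderiv (pderiv f) * g) +
            (B (pderiv f * g) + B (f * pderiv g)) + C (f * g) = C' (f * g)"
          using 3 by (simp add: pderiv_mult pderiv_add l algebra_simps t)
        moreover have "2 * (A (f * pderiv (pderiv g)) + A (pderiv f * pderiv g)) +
            B (f * pderiv g) + B' (f * pderiv g) = 0"
          using 2 by (simp add: pderiv_mult l algebra_simps)
        moreover have "a + b + c = a2 + b' + c'"
          if "a2 + 2 * k + a + (b + b2) + c = c'" "2 * (a2 + k) + b2 + b' = 0"
          for a a2 b b2 b' c c' k :: complex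
        proof -
          have "a2 + b' + (a2 + 2 * k + a + (b + b2) + c) = a + b + c + (2 * (a2 + k) + b2 + b')"
            by simp
          then show ?thesis unfolding that by simp
        qed
        ultimately show ?thesis unfolding 1[symmetric] by blast
      qed
    qed
  qed
qed

text \<open>
  Conjugation of the coefficients; at real points it is conjugation of the value.
\<close>

abbreviation cnj_poly :: "complex poly \<Rightarrow> complex poly" where
  "cnj_poly \<equiv> map_poly cnj"

lemma cnj_poly_simps [simp]:
  "cnj_poly (p + q) = cnj_poly p + cnj_poly q"
  "cnj_poly (p * q) = cnj_poly p * cnj_poly q"
  "cnj_poly (smult c p) = smult (cnj c) (cnj_poly p)"
  "cnj_poly (pderiv p) = pderiv (cnj_poly p)"
  "cnj_poly (cnj_poly p) = p"
  by (auto simp: poly_eq_iff coeff_map_poly coeff_mult coeff_pderiv)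

lemma cnj_poly_sum: "cnj_poly (\<Sum>i\<in>I. p i) = (\<Sum>i\<in>I. cnj_poly (p i))"
  by (induction I rule: infinite_finite_induct) auto

lemma poly_cnj_poly_of_real:
  "poly (cnj_poly p) (complex_of_real t) = cnj (poly p (complex_of_real t))"
  by simp

text \<open>
  All moments of all entries exist.
\<close>

definition finite_moments :: "'n::finite matrix_measure \<Rightarrow> bool" where
  "finite_moments W \<longleftrightarrow>
     (\<forall>(n::nat) i j. cmeasure_integrable (\<lambda>\<Omega>. W \<Omega> $ i $ j) (\<lambda>t. complex_of_real (t ^ n)))"

text \<open>
  The functional \<open>p \<mapsto> \<integral> p dW\<^sub>k\<^sub>l\<close>.  It is linear without conjugation in either index.
\<close>

definition moment_functional :: "'n::finite matrix_measure \<Rightarrow> 'n \<Rightarrow> 'n \<Rightarrow> complex poly \<Rightarrow> complex" where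
  "moment_functional W k l p =
     cmeasure_integral (\<lambda>\<Omega>. W \<Omega> $ k $ l) (\<lambda>t. poly p (complex_of_real t))"

lemma poly_of_real_measurable [measurable]:
  "(\<lambda>t. poly p (complex_of_real t)) \<in> borel_measurable borel"
  by (intro borel_measurable_continuous_onI continuous_intros)

lemma cmeasure_integrable_poly:
  assumes \<nu>: "finite_cmeasure \<nu>" and m: "\<And>n. cmeasure_integrable \<nu> (\<lambda>t. complex_of_real (t ^ n))"
  shows "cmeasure_integrable \<nu> (\<lambda>t. poly p (complex_of_real t))"
proof -
  have "cmeasure_integrable \<nu> (\<lambda>t. poly (\<Sum>i\<in>I. monom (c i) i) (complex_of_real t))"
    if "finite I" for I c
    using that
  proof (induction I)
    case empty
    then show ?case by (simp add: cmeasure_integrable_def signed_integrable_def)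
  next
    case (insert i I)
    then have "cmeasure_integrable \<nu> (\<lambda>t. poly (\<Sum>i\<in>I. monom (c i) i) (complex_of_real t) +
       c i * complex_of_real (t ^ i))"
      by (intro cmeasure_integral_linear(1) \<nu> m) auto
    then show ?case using insert.hyps by (simp add: poly_monom add.commute)
  qed
  from this[of "{..degree p}" "coeff p"] show ?thesis
    by (simp add: poly_as_sum_of_monoms)
qed

lemma poly_functional_cmeasure_integral:
  assumes \<nu>: "finite_cmeasure \<nu>" and m: "\<And>n. cmeasure_integrable \<nu> (\<lambda>t. complex_of_real (t ^ n))"
  shows "poly_functional (\<lambda>p. cmeasure_integral \<nu> (\<lambda>t. poly p (complex_of_real t)))"
proof -
  have l: "cmeasure_integral \<nu> (\<lambda>t. poly (p + smult z q) (complex_of_real t)) =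
    cmeasure_integral \<nu> (\<lambda>t. poly p (complex_of_real t)) + z * cmeasure_integral \<nu> (\<lambda>t. poly q (complex_of_real t))"
    for p q z
    using cmeasure_integral_linear(2)[OF \<nu> _ cmeasure_integrable_poly[OF \<nu> m] _ cmeasure_integrable_poly[OF \<nu> m]]
    by simp
  show ?thesis
    unfolding poly_functional_def using l[of _ 1] l[of 0] 
    by (auto simp: cmeasure_integral_def signed_integral_def)
qed

lemma poly_functional_moment_functional:
  assumes "psd_measure W" "finite_moments W" shows "poly_functional (moment_functional W k l)"
  using poly_functional_cmeasure_integral[OF psd_measure_finite_cmeasure[OF assms(1)]] assms(2)
  by (simp add: moment_functional_def[abs_def] finite_moments_def)

lemma sandwich_integral_poly:
  fixes W :: "'n::finite matrix_measure"
  assumes "\<And>t i k. F t $ i $ k = poly (f i k) (complex_of_real t)"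
    and "\<And>t j l. G t $ j $ l = poly (g j l) (complex_of_real t)"
  shows "sandwich_integral F W G $ i $ j =
    (\<Sum>k\<in>UNIV. \<Sum>l\<in>UNIV. moment_functional W k l (f i k * cnj_poly (g j l)))"
  by (simp add: sandwich_integral_def moment_functional_def conj_transpose_def assms)

text \<open>
  The operator acting on a row of polynomials; \<open>row_op F2 F1 F0 p k\<close> is the \<open>k\<close>-th entry of
  \<open>p'' F\<^sub>2 + p' F\<^sub>1 + p F\<^sub>0\<close>.
\<close>

definition row_op :: "complex poly^'n^'n \<Rightarrow> complex poly^'n^'n \<Rightarrow> complex^'n^'n \<Rightarrow>
    ('n::finite \<Rightarrow> complex poly) \<Rightarrow> 'n \<Rightarrow> complex poly" where
  "row_op F2 F1 F0 p k =
     (\<Sum>i\<in>UNIV. pderiv (pderiv (p i)) * F2 $ i $ k + pderiv (p i) * F1 $ i $ k + smult (F0 $ i $ k) (p i))"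

lemma diff_op_poly:
  "diff_op (mpoly_eval F2) (mpoly_eval F1) F0 P t $ i $ k =
     poly (row_op F2 F1 F0 (\<lambda>r. P $ i $ r) k) (complex_of_real t)"
  by (simp add: diff_op_def row_op_def mpoly_eval_def mpoly_deriv_def matrix_matrix_mult_def
      poly_sum sum.distrib mult.commute)

lemma symmetric_wrt_iff_rows:
  fixes W :: "'n::finite matrix_measure"
  assumes real: "\<And>i k. cnj_poly (F2 $ i $ k) = F2 $ i $ k" "\<And>i k. cnj_poly (F1 $ i $ k) = F1 $ i $ k"
    "\<And>i k. cnj (F0 $ i $ k) = F0 $ i $ k"
  shows "symmetric_wrt (diff_op (mpoly_eval F2) (mpoly_eval F1) F0) W \<longleftrightarrow>
    (\<forall>p q. (\<Sum>k\<in>UNIV. \<Sum>l\<in>UNIV. moment_functional W k l (row_op F2 F1 F0 p k * q l)) =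
           (\<Sum>k\<in>UNIV. \<Sum>l\<in>UNIV. moment_functional W k l (p k * row_op F2 F1 F0 q l)))"
    (is "?L \<longleftrightarrow> ?R")
proof -
  let ?D = "diff_op (mpoly_eval F2) (mpoly_eval F1) F0"
  have c: "cnj_poly (row_op F2 F1 F0 q l) = row_op F2 F1 F0 (\<lambda>r. cnj_poly (q r)) l" for q l
    by (simp add: row_op_def cnj_poly_sum real)
  have e: "mpoly_eval P t $ i $ k = poly (P $ i $ k) (complex_of_real t)" for P :: "complex poly^'n^'n" and t i k
    by (simp add: mpoly_eval_def)
  have s1: "sandwich_integral (?D P) W (mpoly_eval Q) $ i $ j = (\<Sum>k\<in>UNIV. \<Sum>l\<in>UNIV.
     moment_functional W k l (row_op F2 F1 F0 (\<lambda>r. P $ i $ r) k * cnj_poly (Q $ j $ l)))" for P Q i j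
    by (rule sandwich_integral_poly[OF diff_op_poly e])
  have s2: "sandwich_integral (mpoly_eval P) W (?D Q) $ i $ j = (\<Sum>k\<in>UNIV. \<Sum>l\<in>UNIV.
     moment_functional W k l (P $ i $ k * row_op F2 F1 F0 (\<lambda>r. cnj_poly (Q $ j $ r)) l))" for P Q i j
    unfolding c[symmetric] by (rule sandwich_integral_poly[OF e diff_op_poly])
  show ?thesis
  proof
    assume L: ?L
    show ?R
    proof (intro allI)
      fix p q :: "'n \<Rightarrow> complex poly"
      have "sandwich_integral (?D (\<chi> i k. p k)) W (mpoly_eval (\<chi> j l. cnj_poly (q l))) =
         sandwich_integral (mpoly_eval (\<chi> i k. p k)) W (?D (\<chi> j l. cnj_poly (q l)))"
        using L by (auto simp: symmetric_wrt_def)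
      then have "sandwich_integral (?D (\<chi> i k. p k)) W (mpoly_eval (\<chi> j l. cnj_poly (q l))) $ undefined $ undefined =
         sandwich_integral (mpoly_eval (\<chi> i k. p k)) W (?D (\<chi> j l. cnj_poly (q l))) $ undefined $ undefined"
        by simp
      moreover have "($) (vec_lambda p) = p" "($) (vec_lambda q) = q"
        by (simp_all add: fun_eq_iff)
      ultimately show "(\<Sum>k\<in>UNIV. \<Sum>l\<in>UNIV. moment_functional W k l (row_op F2 F1 F0 p k * q l)) =
           (\<Sum>k\<in>UNIV. \<Sum>l\<in>UNIV. moment_functional W k l (p k * row_op F2 F1 F0 q l))"
        unfolding s1 s2 by simp
    qed
  next
    assume R: ?R
    show ?L
      unfolding symmetric_wrt_def vec_eq_iff s1 s2
    proof (intro allI)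
      fix P Q :: "complex poly^'n^'n" and i j
      show "(\<Sum>k\<in>UNIV. \<Sum>l\<in>UNIV.
          moment_functional W k l (row_op F2 F1 F0 (\<lambda>r. P $ i $ r) k * cnj_poly (Q $ j $ l))) =
        (\<Sum>k\<in>UNIV. \<Sum>l\<in>UNIV.
          moment_functional W k l (P $ i $ k * row_op F2 F1 F0 (\<lambda>r. cnj_poly (Q $ j $ r)) l))"
        using R[rule_format, of "\<lambda>r. P $ i $ r" "\<lambda>r. cnj_poly (Q $ j $ r)"] .
    qed
  qed
qed

text \<open>
  The entry \<open>(i, j)\<close> of the product \<open>F L\<close> of a matrix polynomial and a matrix of functionals, where a
  polynomial times a functional is the functional applied to the product.
\<close>

definition left_mult :: "('n \<Rightarrow> 'n \<Rightarrow> complex poly \<Rightarrow> complex) \<Rightarrow> complex poly^'n^'n \<Rightarrow>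
    'n::finite \<Rightarrow> 'n \<Rightarrow> complex poly \<Rightarrow> complex" where
  "left_mult L F i j f = (\<Sum>k\<in>UNIV. L k j (F $ i $ k * f))"

text \<open>
  The entry \<open>(i, j)\<close> of \<open>L F\<^sup>T\<close>; for polynomials with real coefficients, at real points, the transpose
  is the conjugate transpose.
\<close>

definition right_mult :: "('n \<Rightarrow> 'n \<Rightarrow> complex poly \<Rightarrow> complex) \<Rightarrow> complex poly^'n^'n \<Rightarrow>
    'n::finite \<Rightarrow> 'n \<Rightarrow> complex poly \<Rightarrow> complex" where
  "right_mult L F i j f = (\<Sum>k\<in>UNIV. L i k (F $ j $ k * f))"

text \<open>
  A constant matrix as a matrix polynomial.
\<close>

definition const_mpoly :: "complex^'n^'n \<Rightarrow> complex poly^'n^'n" where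
  "const_mpoly F = (\<chi> i j. [:F $ i $ j:])"

lemma poly_functional_mult:
  assumes "\<And>i j. poly_functional (L i j)"
  shows "poly_functional (left_mult L F i j)" "poly_functional (right_mult L F i j)"
  using assms unfolding poly_functional_def left_mult_def right_mult_def
  by (auto simp: distrib_left sum.distrib sum_distrib_left)

text \<open>
  The equations \<open>F\<^sub>2 L = L F\<^sub>2\<^sup>T\<close>, \<open>2 (F\<^sub>2 L)' = F\<^sub>1 L + L F\<^sub>1\<^sup>T\<close> and
  \<open>(F\<^sub>2 L)'' - (F\<^sub>1 L)' + F\<^sub>0 L = L F\<^sub>0\<^sup>T\<close>, where the derivative of a functional \<open>\<Lambda>\<close> is \<open>f \<mapsto> - \<Lambda> f'\<close>.
\<close>

definition moment_equations :: "('n::finite \<Rightarrow> 'n \<Rightarrow> complex poly \<Rightarrow> complex) \<Rightarrow>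
    complex poly^'n^'n \<Rightarrow> complex poly^'n^'n \<Rightarrow> complex^'n^'n \<Rightarrow> bool" where
  "moment_equations L F2 F1 F0 \<longleftrightarrow> (\<forall>i j.
     (\<forall>f. left_mult L F2 i j f = right_mult L F2 i j f) \<and>
     (\<forall>f. 2 * left_mult L F2 i j (pderiv f) + left_mult L F1 i j f + right_mult L F1 i j f = 0) \<and>
     (\<forall>f. left_mult L F2 i j (pderiv (pderiv f)) + left_mult L F1 i j (pderiv f) +
        left_mult L (const_mpoly F0) i j f = right_mult L (const_mpoly F0) i j f))"

lemma symmetric_rows_iff_moment_equations:
  fixes L :: "'n::finite \<Rightarrow> 'n \<Rightarrow> complex poly \<Rightarrow> complex"
  assumes lin: "\<And>i j. poly_functional (L i j)"
  shows "(\<forall>p q. (\<Sum>k\<in>UNIV. \<Sum>l\<in>UNIV. L k l (row_op F2 F1 F0 p k * q l)) =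
           (\<Sum>k\<in>UNIV. \<Sum>l\<in>UNIV. L k l (p k * row_op F2 F1 F0 q l))) \<longleftrightarrow>
    moment_equations L F2 F1 F0" (is "?S \<longleftrightarrow> _")
proof -
  let ?A = "left_mult L F2" and ?B = "left_mult L F1" and ?C = "left_mult L (const_mpoly F0)"
  let ?A' = "right_mult L F2" and ?B' = "right_mult L F1" and ?C' = "right_mult L (const_mpoly F0)"
  define X where "X i j f g = ?A i j (pderiv (pderiv f) * g) + ?B i j (pderiv f * g) + ?C i j (f * g)" for i j f g
  define Y where "Y i j f g = ?A' i j (f * pderiv (pderiv g)) + ?B' i j (f * pderiv g) + ?C' i j (f * g)" for i j f g
  have ll: "(\<Sum>k\<in>UNIV. \<Sum>l\<in>UNIV. L k l (row_op F2 F1 F0 p k * q l)) = (\<Sum>i\<in>UNIV. \<Sum>j\<in>UNIV. X i j (p i) (q j))"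
    for p q
  proof -
    have "(\<Sum>k\<in>UNIV. \<Sum>l\<in>UNIV. L k l (row_op F2 F1 F0 p k * q l)) =
      (\<Sum>k\<in>UNIV. \<Sum>l\<in>UNIV. \<Sum>i\<in>UNIV. L k l (F2 $ i $ k * (pderiv (pderiv (p i)) * q l)) +
         L k l (F1 $ i $ k * (pderiv (p i) * q l)) + L k l ([:F0 $ i $ k:] * (p i * q l)))"
      unfolding row_op_def sum_distrib_right poly_functional_sum[OF lin]
      by (simp add: algebra_simps poly_functionalD(1)[OF lin])
    also have "\<dots> = (\<Sum>k\<in>UNIV. \<Sum>i\<in>UNIV. \<Sum>l\<in>UNIV. L k l (F2 $ i $ k * (pderiv (pderiv (p i)) * q l)) +
         L k l (F1 $ i $ k * (pderiv (p i) * q l)) + L k l ([:F0 $ i $ k:] * (p i * q l)))"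
      by (intro sum.cong sum.swap refl)
    also have "\<dots> = (\<Sum>i\<in>UNIV. \<Sum>k\<in>UNIV. \<Sum>l\<in>UNIV. L k l (F2 $ i $ k * (pderiv (pderiv (p i)) * q l)) +
         L k l (F1 $ i $ k * (pderiv (p i) * q l)) + L k l ([:F0 $ i $ k:] * (p i * q l)))"
      by (rule sum.swap)
    also have "\<dots> = (\<Sum>i\<in>UNIV. \<Sum>l\<in>UNIV. \<Sum>k\<in>UNIV. L k l (F2 $ i $ k * (pderiv (pderiv (p i)) * q l)) +
         L k l (F1 $ i $ k * (pderiv (p i) * q l)) + L k l ([:F0 $ i $ k:] * (p i * q l)))"
      by (intro sum.cong sum.swap refl)
    finally show ?thesis
      by (simp only: X_def left_mult_def const_mpoly_def sum.distrib vec_lambda_beta)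
  qed
  have rr: "(\<Sum>k\<in>UNIV. \<Sum>l\<in>UNIV. L k l (p k * row_op F2 F1 F0 q l)) = (\<Sum>i\<in>UNIV. \<Sum>j\<in>UNIV. Y i j (p i) (q j))"
    for p q
  proof -
    have "(\<Sum>k\<in>UNIV. \<Sum>l\<in>UNIV. L k l (p k * row_op F2 F1 F0 q l)) =
      (\<Sum>k\<in>UNIV. \<Sum>l\<in>UNIV. \<Sum>j\<in>UNIV. L k l (F2 $ j $ l * (p k * pderiv (pderiv (q j)))) +
         L k l (F1 $ j $ l * (p k * pderiv (q j))) + L k l ([:F0 $ j $ l:] * (p k * q j)))"
      unfolding row_op_def sum_distrib_left poly_functional_sum[OF lin]
      by (simp add: algebra_simps poly_functionalD(1)[OF lin])
    also have "\<dots> = (\<Sum>k\<in>UNIV. \<Sum>j\<in>UNIV. \<Sum>l\<in>UNIV. L k l (F2 $ j $ l * (p k * pderiv (pderiv (q j)))) +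
         L k l (F1 $ j $ l * (p k * pderiv (q j))) + L k l ([:F0 $ j $ l:] * (p k * q j)))"
      by (intro sum.cong sum.swap refl)
    finally show ?thesis
      by (simp only: Y_def right_mult_def const_mpoly_def sum.distrib vec_lambda_beta)
  qed
  note lm = poly_functional_mult[OF lin]
  have z: "X i j 0 g = 0" "X i j f 0 = 0" "Y i j 0 g = 0" "Y i j f 0 = 0" for i j f g
    by (simp_all add: X_def Y_def poly_functionalD(3)[OF lm(1)] poly_functionalD(3)[OF lm(2)])
  have "?S \<longleftrightarrow> (\<forall>i j f g. X i j f g = Y i j f g)"
  proof
    assume S: ?S
    show "\<forall>i j f g. X i j f g = Y i j f g"
    proof (intro allI)
      fix i j f g
      have dX: "X i' j' (if i' = i then f else 0) (if j' = j then g else 0) =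
         (if j' = j then if i' = i then X i j f g else 0 else 0)" for i' j'
        by (simp add: z)
      have dY: "Y i' j' (if i' = i then f else 0) (if j' = j then g else 0) =
         (if j' = j then if i' = i then Y i j f g else 0 else 0)" for i' j'
        by (simp add: z)
      show "X i j f g = Y i j f g"
        using S[rule_format, of "\<lambda>i'. if i' = i then f else 0" "\<lambda>j'. if j' = j then g else 0"]
        unfolding ll rr dX dY by simp
    qed
  qed (simp add: ll rr)
  also have "\<dots> \<longleftrightarrow> moment_equations L F2 F1 F0"
    unfolding X_def Y_def moment_equations_def
    by (simp only: moment_equations_iff[OF lm(1) lm(1) lm(1) lm(2) lm(2) lm(2)])
  finally show ?thesis .
qed

theorem symmetric_wrt_iff_moment_equations:
  fixes W :: "'n::finite matrix_measure"
  assumes "psd_measure W" "finite_moments W"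
    and "\<And>i k. cnj_poly (F2 $ i $ k) = F2 $ i $ k" "\<And>i k. cnj_poly (F1 $ i $ k) = F1 $ i $ k"
    "\<And>i k. cnj (F0 $ i $ k) = F0 $ i $ k"
  shows "symmetric_wrt (diff_op (mpoly_eval F2) (mpoly_eval F1) F0) W \<longleftrightarrow>
    moment_equations (moment_functional W) F2 F1 F0"
  unfolding symmetric_wrt_iff_rows[OF assms(3-5)]
  by (intro symmetric_rows_iff_moment_equations poly_functional_moment_functional assms)


section \<open>The Gaussian functional\<close>

lemma poly_functional_eqI:
  assumes "poly_functional L" "poly_functional M" "\<And>n. L (monom 1 n) = M (monom 1 n)"
  shows "L p = M p"
proof -
  have "L (\<Sum>i\<le>degree p. smult (coeff p i) (monom 1 i)) = M (\<Sum>i\<le>degree p. smult (coeff p i) (monom 1 i))"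
    unfolding poly_functional_sum[OF assms(1)] poly_functional_sum[OF assms(2)]
    by (simp only: poly_functionalD(2)[OF assms(1)] poly_functionalD(2)[OF assms(2)] assms(3))
  then show ?thesis by (simp add: smult_monom poly_as_sum_of_monoms)
qed

lemma poly_functional_cmult: "poly_functional L \<Longrightarrow> poly_functional (\<lambda>p. k * L p)"
  by (simp add: poly_functional_def distrib_left)

text \<open>
  The moments of \<open>e\<^bsup>-t\<^sup>2\<^esup> dt\<close>.
\<close>

definition gauss_moment :: "nat \<Rightarrow> real" where
  "gauss_moment n = (LINT t|lborel. exp (- t\<^sup>2) * t ^ n)"

lemma gauss_moment_even:
  "has_bochner_integral lborel (\<lambda>t::real. exp (- t\<^sup>2) * t ^ (2 * k))
     (sqrt pi * (fact (2 * k) / (2 ^ (2 * k) * fact k)))"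
  using has_bochner_integral_even_function[OF gaussian_moment_even_pos[where k=k]] by simp

lemma gauss_moment_odd:
  "has_bochner_integral lborel (\<lambda>t::real. exp (- t\<^sup>2) * t ^ (2 * k + 1)) 0"
  using gaussian_moment_odd_pos by (rule has_bochner_integral_odd_function) simp

lemma gauss_moment_integrable: "integrable lborel (\<lambda>t::real. exp (- t\<^sup>2) * t ^ n)"
  using gauss_moment_even[of "n div 2"] gauss_moment_odd[of "n div 2"]
  by (cases "even n") (auto simp: has_bochner_integral_iff elim!: evenE oddE)

lemma gauss_moment_0: "gauss_moment 0 = sqrt pi"
  and gauss_moment_1: "gauss_moment (Suc 0) = 0"
  using gauss_moment_even[of 0] gauss_moment_odd[of 0]
  by (auto simp: gauss_moment_def has_bochner_integral_iff)

lemma gauss_moment_Suc_Suc: "2 * gauss_moment (Suc (Suc n)) = real (Suc n) * gauss_moment n"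
proof (cases "even n")
  case True
  then obtain k where n: "n = 2 * k" by (auto elim: evenE)
  have "gauss_moment (2 * k) = sqrt pi * (fact (2 * k) / (2 ^ (2 * k) * fact k))"
    "gauss_moment (2 * Suc k) = sqrt pi * (fact (2 * Suc k) / (2 ^ (2 * Suc k) * fact (Suc k)))"
    using gauss_moment_even[of k] gauss_moment_even[of "Suc k"]
    by (simp_all only: gauss_moment_def has_bochner_integral_iff)
  moreover have "2 * (sqrt pi * (fact (2 * Suc k) / (2 ^ (2 * Suc k) * fact (Suc k)))) =
     (2 * real k + 1) * (sqrt pi * (fact (2 * k) / (2 ^ (2 * k) * fact k)))"
  proof -
    have f: "fact (2 * Suc k) = 2 * (real k + 1) * (2 * real k + 1) * fact (2 * k)"
      "(2::real) ^ (2 * Suc k) = 4 * 2 ^ (2 * k)" "fact (Suc k) = (real k + 1) * fact k"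
      by (simp_all add: algebra_simps)
    show ?thesis unfolding f by (simp add: divide_simps)
  qed
  ultimately show ?thesis unfolding n by simp
next
  case False
  then obtain k where n: "n = 2 * k + 1" by (auto elim: oddE)
  have "gauss_moment (2 * k + 1) = 0" "gauss_moment (2 * Suc k + 1) = 0"
    using gauss_moment_odd[of k] gauss_moment_odd[of "Suc k"]
    by (simp_all only: gauss_moment_def has_bochner_integral_iff)
  then show ?thesis unfolding n by simp
qed

text \<open>
  Integration of polynomials against \<open>e\<^bsup>-t\<^sup>2\<^esup> dt\<close>.
\<close>

definition gauss_functional :: "complex poly \<Rightarrow> complex" where
  "gauss_functional p = (LINT t|lborel. exp (- t\<^sup>2) *\<^sub>R poly p (complex_of_real t))"

lemma gauss_integrable_poly: "integrable lborel (\<lambda>t. exp (- t\<^sup>2) *\<^sub>R poly p (complex_of_real t))"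
proof -
  have "integrable lborel (\<lambda>t. coeff p i * complex_of_real (exp (- t\<^sup>2) * t ^ i))" for i
    by (intro integrable_mult_right integrable_of_real gauss_moment_integrable)
  then have "integrable lborel (\<lambda>t. \<Sum>i\<le>degree p. coeff p i * complex_of_real (exp (- t\<^sup>2) * t ^ i))"
    by (intro Bochner_Integration.integrable_sum)
  then show ?thesis
    by (simp add: poly_altdef scaleR_conv_of_real sum_distrib_left mult_ac)
qed

lemma poly_functional_gauss: "poly_functional gauss_functional"
proof -
  have "gauss_functional (p + q) = gauss_functional p + gauss_functional q" for p q
    unfolding gauss_functional_def
    using Bochner_Integration.integral_add[OF gauss_integrable_poly[of p] gauss_integrable_poly[of q]]
    by (simp add: scaleR_add_right)
  moreover have "gauss_functional (smult c p) = c * gauss_functional p" for c p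
    unfolding gauss_functional_def
    by (subst integral_mult_right_zero[symmetric]) (simp add: scaleR_conv_of_real mult_ac)
  ultimately show ?thesis by (simp add: poly_functional_def)
qed

lemma gauss_functional_monom: "gauss_functional (monom 1 n) = complex_of_real (gauss_moment n)"
  unfolding gauss_functional_def gauss_moment_def integral_complex_of_real[symmetric]
  by (simp add: poly_monom scaleR_conv_of_real)

lemma poly_functional_pearson:
  assumes L: "poly_functional L"
  shows "poly_functional (\<lambda>p. L (pderiv p - [:0, 2:] * p))"
proof -
  have 1: "pderiv (p + q) - [:0, 2:] * (p + q) = (pderiv p - [:0, 2:] * p) + (pderiv q - [:0, 2:] * q)"
    for p q :: "complex poly" by (simp add: pderiv_add algebra_simps smult_add_right)
  have 2: "pderiv (smult c p) - [:0, 2:] * smult c p = smult c (pderiv p - [:0, 2:] * p)"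
    for p :: "complex poly" and c by (simp add: pderiv_smult algebra_simps smult_diff_right)
  show ?thesis
    unfolding poly_functional_def 1 2 poly_functionalD(1,2)[OF L] by blast
qed

lemma pearson_monom:
  "pderiv (monom 1 n) - [:0, 2:] * monom 1 n =
     smult (of_nat n) (monom 1 (n - 1)) - smult 2 (monom (1::complex) (Suc n))"
  by (simp add: pderiv_monom smult_monom monom_Suc)

lemma gauss_functional_pearson: "gauss_functional (pderiv p - [:0, 2:] * p) = 0"
proof -
  have "gauss_functional (pderiv p - [:0, 2:] * p) = 0"
  proof (rule poly_functional_eqI[where L = "\<lambda>p. gauss_functional (pderiv p - [:0, 2:] * p)" and M = "\<lambda>p. 0"])
    show "poly_functional (\<lambda>p. gauss_functional (pderiv p - [:0, 2:] * p))"
      by (rule poly_functional_pearson[OF poly_functional_gauss])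
    show "gauss_functional (pderiv (monom 1 n) - [:0, 2:] * monom 1 n) = 0" for n
    proof -
      have "real n * gauss_moment (n - 1) = 2 * gauss_moment (Suc n)"
        using gauss_moment_Suc_Suc[of "n - 1"] gauss_moment_1 by (cases n) auto
      then have "complex_of_real (real n * gauss_moment (n - 1)) = complex_of_real (2 * gauss_moment (Suc n))"
        by (rule arg_cong)
      then show ?thesis
        unfolding pearson_monom poly_functionalD[OF poly_functional_gauss] gauss_functional_monom by simp
    qed
  qed (simp add: poly_functional_def)
  then show ?thesis by simp
qed

text \<open>
  The equation \<open>\<Lambda>' + 2 t \<Lambda> = 0\<close> for a functional \<open>\<Lambda>\<close> is a recursion for its moments, so the Gaussian
  functional is its only solution up to a factor, the constant \<open>sqrt pi\<close> being the Gaussian integral of \<open>1\<close>.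
\<close>

lemma pearson_unique:
  assumes L: "poly_functional L" and 0: "\<And>p. L (pderiv p - [:0, 2:] * p) = 0"
  shows "L p = (L 1 / complex_of_real (sqrt pi)) * gauss_functional p"
proof (rule poly_functional_eqI[OF L])
  show "poly_functional (\<lambda>p. L 1 / complex_of_real (sqrt pi) * gauss_functional p)"
    by (rule poly_functional_cmult[OF poly_functional_gauss])
  have rec: "2 * L (monom 1 (Suc n)) = of_nat n * L (monom 1 (n - 1))" for n
    using 0[of "monom 1 n"] unfolding pearson_monom poly_functionalD[OF L] by simp
  have "L (monom 1 n) = L 1 / complex_of_real (sqrt pi) * complex_of_real (gauss_moment n) \<and>
    L (monom 1 (Suc n)) = L 1 / complex_of_real (sqrt pi) * complex_of_real (gauss_moment (Suc n))" for n
  proof (induction n)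
    case 0
    then show ?case
      using rec[of 0] by (simp add: gauss_moment_0 gauss_moment_1 monom_0 one_pCons)
  next
    case (Suc n)
    have g: "complex_of_real (gauss_moment (Suc (Suc n))) = of_nat (Suc n) / 2 * complex_of_real (gauss_moment n)"
      using arg_cong[OF gauss_moment_Suc_Suc[of n], of complex_of_real] by (simp add: field_simps)
    have "L (monom 1 (Suc (Suc n))) = of_nat (Suc n) / 2 * L (monom 1 n)"
      using rec[of "Suc n"] by (simp add: field_simps)
    then show ?case using Suc unfolding g by (simp add: mult_ac)
  qed
  then show "L (monom 1 n) = L 1 / complex_of_real (sqrt pi) * gauss_functional (monom 1 n)" for n
    unfolding gauss_functional_monom by blast
qed

lemma gauss_functional_parts:
  "gauss_functional (p * pderiv f) = - gauss_functional ((pderiv p - [:0, 2:] * p) * f)"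
proof -
  have e: "pderiv (p * f) - [:0, 2:] * (p * f) = p * pderiv f + (pderiv p - [:0, 2:] * p) * f"
    by (simp add: pderiv_mult algebra_simps)
  have "gauss_functional (p * pderiv f) + gauss_functional ((pderiv p - [:0, 2:] * p) * f) = 0"
    using gauss_functional_pearson[of "p * f"]
    unfolding e poly_functionalD(1)[OF poly_functional_gauss] .
  then show ?thesis by (simp add: add_eq_0_iff2)
qed

text \<open>
  Completing the square turns the factor \<open>exp (c t)\<close> into a translation of the Gaussian.
\<close>

lemma gauss_exp_integrable_poly:
  "integrable lborel (\<lambda>t. exp (- t\<^sup>2) *\<^sub>R (complex_of_real (exp (c * t)) * poly p (complex_of_real t)))"
proof -
  have "integrable lborel (\<lambda>t. exp (- (- c / 2 + 1 * t)\<^sup>2) *\<^sub>R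
     poly (p \<circ>\<^sub>p [:complex_of_real (c / 2), 1:]) (complex_of_real (- c / 2 + 1 * t)))"
    by (rule lborel_integrable_real_affine[OF gauss_integrable_poly]) simp
  then have "integrable lborel (\<lambda>t. complex_of_real (exp (c\<^sup>2 / 4)) *
     (exp (- (- c / 2 + 1 * t)\<^sup>2) *\<^sub>R poly (p \<circ>\<^sub>p [:complex_of_real (c / 2), 1:]) (complex_of_real (- c / 2 + 1 * t))))"
    by (rule integrable_mult_right)
  also have "(\<lambda>t. complex_of_real (exp (c\<^sup>2 / 4)) *
     (exp (- (- c / 2 + 1 * t)\<^sup>2) *\<^sub>R poly (p \<circ>\<^sub>p [:complex_of_real (c / 2), 1:]) (complex_of_real (- c / 2 + 1 * t)))) =
    (\<lambda>t. exp (- t\<^sup>2) *\<^sub>R (complex_of_real (exp (c * t)) * poly p (complex_of_real t)))"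
  proof
    fix t
    have "exp (c\<^sup>2 / 4) * exp (- (- c / 2 + 1 * t)\<^sup>2) = exp (- t\<^sup>2) * exp (c * t)"
      unfolding exp_add[symmetric] by (rule arg_cong[of _ _ exp]) (simp add: power2_eq_square field_simps)
    then have e: "complex_of_real (exp (c\<^sup>2 / 4)) * complex_of_real (exp (- (- c / 2 + 1 * t)\<^sup>2)) =
       complex_of_real (exp (- t\<^sup>2)) * complex_of_real (exp (c * t))"
      unfolding of_real_mult[symmetric] by (rule arg_cong)
    have "poly (p \<circ>\<^sub>p [:complex_of_real (c / 2), 1:]) (complex_of_real (- c / 2 + 1 * t)) = poly p (complex_of_real t)"
      by (simp add: poly_pcompose)
    then show "complex_of_real (exp (c\<^sup>2 / 4)) * (exp (- (- c / 2 + 1 * t)\<^sup>2) *\<^sub>R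
         poly (p \<circ>\<^sub>p [:complex_of_real (c / 2), 1:]) (complex_of_real (- c / 2 + 1 * t))) =
       exp (- t\<^sup>2) *\<^sub>R (complex_of_real (exp (c * t)) * poly p (complex_of_real t))"
      using e unfolding scaleR_conv_of_real by (simp only: mult.assoc[symmetric])
  qed
  finally show ?thesis .
qed

lemma gauss_functional_square:
  shows "Im (gauss_functional (p * cnj_poly p)) = 0" "0 \<le> Re (gauss_functional (p * cnj_poly p))"
    "gauss_functional (p * cnj_poly p) = 0 \<Longrightarrow> p = 0"
proof -
  define h where "h t = exp (- t\<^sup>2) * (cmod (poly p (complex_of_real t)))\<^sup>2" for t
  have e: "exp (- t\<^sup>2) *\<^sub>R poly (p * cnj_poly p) (complex_of_real t) = complex_of_real (h t)" for t
    by (simp add: h_def scaleR_conv_of_real complex_norm_square del: of_real_power)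
  have g: "gauss_functional (p * cnj_poly p) = complex_of_real (LINT t|lborel. h t)"
    unfolding gauss_functional_def e by simp
  have h0: "0 \<le> h t" for t by (simp add: h_def)
  show "Im (gauss_functional (p * cnj_poly p)) = 0" "0 \<le> Re (gauss_functional (p * cnj_poly p))"
    unfolding g using h0 by simp_all
  have ih: "integrable lborel h"
    using gauss_integrable_poly[of "p * cnj_poly p"] unfolding e by (simp add: complex_of_real_integrable_eq)
  assume "gauss_functional (p * cnj_poly p) = 0"
  then have "(LINT t|lborel. h t) = 0" unfolding g by simp
  then have "AE t in lborel. h t = 0"
    using integral_nonneg_eq_0_iff_AE[OF ih] h0 by simp
  moreover have "{t. h t = 0} = {t. poly p (complex_of_real t) = 0}" by (simp add: h_def)
  ultimately have ae: "AE t in lborel. poly p (complex_of_real t) = 0" by (simp add: h_def)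
  show "p = 0"
  proof (rule ccontr)
    assume "p \<noteq> 0"
    then have "finite {z. poly p z = 0}" by (rule poly_roots_finite)
    then have fin: "finite {t. poly p (complex_of_real t) = 0}"
      using finite_vimageI[of "{z. poly p z = 0}" complex_of_real] by (simp add: vimage_def inj_def)
    then have "AE t in lborel. \<not> poly p (complex_of_real t) = 0"
      using AE_not_in[OF finite_imp_null_set_lborel[OF fin]] by simp
    with ae have "AE t::real in lborel. False" by eventually_elim simp
    then show False
      using AE_iff_measurable[of UNIV "lborel :: real measure" "\<lambda>_. False"] by simp
  qed
qed


section \<open>Solving the moment equations of the operator\<close>

text \<open>
  The coefficients of the operator as matrix polynomials in complex parameters, with \<open>c\<close> in the place of
  \<open>\<xi>\<^sup>\<mp>\<close>.  Of \<open>c\<close> only \<open>c\<^sup>2 = a t\<^sub>0 c + 1\<close> is used, together with \<open>2 + a c t\<^sub>0 \<noteq> 0\<close> for uniqueness.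
\<close>

definition F2_poly :: "complex \<Rightarrow> complex \<Rightarrow> complex \<Rightarrow> complex poly^2^2" where
  "F2_poly a c t0 = vector
     [vector [[:a * t0 - c, - a:], [:- 1, - (a\<^sup>2 * t0), a\<^sup>2:]],
      vector [[:- 1:], [:- c, a:]]]"

definition F1_poly :: "complex \<Rightarrow> complex \<Rightarrow> complex \<Rightarrow> complex poly^2^2" where
  "F1_poly a c t0 = vector
     [vector [[:- 2 * a, 2 * c:], [:- 2 * t0 - 2 * a * c, 2 * (2 + a\<^sup>2):]],
      vector [[:2 * t0:], [:0, 2 * (c - a * t0):]]]"

definition F0_const :: "complex \<Rightarrow> complex \<Rightarrow> complex \<Rightarrow> complex^2^2" where
  "F0_const a c t0 = vector
     [vector [c + 2 * (t0 / a), 2 * ((2 + a\<^sup>2) / a\<^sup>2)],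
      vector [4 / a\<^sup>2, - c - 2 * (t0 / a)]]"

text \<open>
  The polynomial factor of the weight: \<open>W\<^sub>a(t) = e\<^bsup>-t\<^sup>2\<^esup> weight_poly(t)\<close>.
\<close>

definition weight_poly :: "complex \<Rightarrow> complex poly^2^2" where
  "weight_poly a = vector [vector [[:1, 0, a\<^sup>2:], [:0, a:]], vector [[:0, a:], [:1:]]]"

text \<open>
  The matrix \<open>M\<close> of the point mass, with \<open>x\<close> in the place of \<open>\<xi>\<^sup>\<plusminus>\<close>.
\<close>

definition mass_matrix :: "complex \<Rightarrow> complex^2^2" where
  "mass_matrix x = vector [vector [x\<^sup>2, x], vector [x, 1]]"

text \<open>
  The moment functionals of \<open>\<gamma> W\<^sub>a + \<zeta> \<delta>\<^sub>t\<^sub>0 M\<close>, for arbitrary complex \<open>\<gamma>\<close> and \<open>\<zeta>\<close>.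
\<close>

definition target_functional :: "complex \<Rightarrow> complex \<Rightarrow> complex \<Rightarrow> complex \<Rightarrow> complex \<Rightarrow>
    2 \<Rightarrow> 2 \<Rightarrow> complex poly \<Rightarrow> complex" where
  "target_functional a x t0 \<gamma> \<zeta> i j p =
     \<gamma> * gauss_functional (weight_poly a $ i $ j * p) + \<zeta> * (mass_matrix x $ i $ j * poly p t0)"

lemma vanishing_on_multiples:
  assumes L: "poly_functional L" and 0: "\<And>f. L (pCons 0 f) = t0 * L f"
  shows "L p = L 1 * poly p t0"
proof (rule poly_functional_eqI[OF L])
  show "poly_functional (\<lambda>p. L 1 * poly p t0)"
    by (simp add: poly_functional_def algebra_simps)
  show "L (monom 1 n) = L 1 * poly (monom 1 n) t0" for n
    by (induction n) (simp_all add: monom_0 one_pCons monom_Suc 0)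
qed

text \<open>
  The first two moment equations already determine \<open>L\<close> up to two constants.  The constants are
  read off from the moments of order at most one, because \<open>y = - c \<zeta> \<delta>\<^sub>t\<^sub>0\<close> and \<open>z\<close> is \<open>\<gamma>\<close> times the Gaussian
  functional, for the functionals \<open>y\<close> and \<open>z\<close> below.
\<close>

lemma moment_equations_imp_target:
  assumes lin: "\<And>i j. poly_functional (L i j)"
    and eqs: "moment_equations L (F2_poly a c t0) (F1_poly a c t0) F0"
    and c: "c\<^sup>2 = a * t0 * c + 1" "c \<noteq> 0" "2 + a * c * t0 \<noteq> 0"
  defines "\<zeta> \<equiv> - (L 1 2 1 - a * L 2 2 [:0, 1:]) / c"
  defines "\<gamma> \<equiv> (L 2 2 1 - \<zeta>) / complex_of_real (sqrt pi)"
  shows "L 1 2 = L 2 1" "L i j = target_functional a (a * t0 - c) t0 \<gamma> \<zeta> i j"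
proof -
  note l = poly_functionalD[OF lin]
  define X where "X f = pCons 0 f" for f :: "complex poly"
  have xs: "pCons k p * q = smult k q + X (p * q)" "q * pCons k p = smult k q + X (p * q)" "X 0 = 0" "X (p + q) = X p + X q"
    "X (smult k p) = smult k (X p)" "X (- p) = - X p" "X (p - q) = X p - X q" for p q and k
    by (simp_all add: X_def)
  have E1: "left_mult L (F2_poly a c t0) i j f = right_mult L (F2_poly a c t0) i j f"
    and E2: "2 * left_mult L (F2_poly a c t0) i j (pderiv f) + left_mult L (F1_poly a c t0) i j f +
       right_mult L (F1_poly a c t0) i j f = 0" for i j f
    using eqs unfolding moment_equations_def by blast+
  note defs = left_mult_def right_mult_def F2_poly_def F1_poly_def sum_2
  have sym: "L 1 2 f = L 2 1 f" for f
    using E1[of 2 2 f] by (simp add: defs l)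
  then show sym': "L 1 2 = L 2 1" by auto
  define l22 where "l22 = L 2 2"
  define y where "y f = L 1 2 f - a * l22 (X f)" for f
  define z where "z f = l22 f + y f / c" for f
  have L22: "L 2 2 f = l22 f" for f by (simp add: l22_def)
  have L12: "L 1 2 f = y f + a * l22 (X f)" for f by (simp add: y_def)
  have y_lin: "poly_functional y" and l22_lin: "poly_functional l22"
    unfolding y_def[abs_def] l22_def poly_functional_def by (simp_all add: l xs algebra_simps)
  have z_lin: "poly_functional z"
    using y_lin l22_lin unfolding z_def[abs_def] poly_functional_def
    by (simp add: algebra_simps add_divide_distrib)
  note ylin = y_lin l22_lin z_lin
  note yl = poly_functionalD[OF ylin(1)] poly_functionalD[OF ylin(2)] poly_functionalD[OF ylin(3)]
  have l22: "l22 f = z f - y f / c" for f by (simp add: z_def)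
  have xc: "(a * t0 - c) * c = - 1"
    using c(1) by (simp add: power2_eq_square algebra_simps)
  have L11: "L 1 1 f = l22 f + a\<^sup>2 * t0 * l22 (X f) - a\<^sup>2 * l22 (X (X f)) + 2 * a * L 1 2 (X f) - a * t0 * L 1 2 f"
    for f
    using E1[of 1 2 f] by (simp add: defs l xs L22 algebra_simps del: mult_pCons_left mult_pCons_right)
  \<comment> \<open>The next four facts rewrite both sides of the second equation in terms of \<open>y\<close> and \<open>z\<close>.\<close>
  have A22: "left_mult L (F2_poly a c t0) 2 2 f = - c * z f" for f
    using c(2) by (simp add: defs l xs L22 L12 z_def field_simps del: mult_pCons_left mult_pCons_right)
  have A12: "left_mult L (F2_poly a c t0) 1 2 f = - z f - a * c * z (X f)" for f
  proof -
    have "left_mult L (F2_poly a c t0) 1 2 f = (a * t0 - c) * y f - l22 f - a * y (X f) - a * c * l22 (X f)"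
      by (simp add: defs l xs L22 L12 yl power2_eq_square algebra_simps del: mult_pCons_left mult_pCons_right)
    moreover have "a * t0 - c = - 1 / c" using xc c(2) by (simp add: field_simps)
    ultimately have e: "left_mult L (F2_poly a c t0) 1 2 f = - 1 / c * y f - l22 f - a * y (X f) - a * c * l22 (X f)"
      by (simp only:)
    show ?thesis using c(2) unfolding e z_def by (simp add: field_simps)
  qed
  have B22: "left_mult L (F1_poly a c t0) 2 2 f + right_mult L (F1_poly a c t0) 2 2 f =
     4 * t0 * y f + 4 * c * z (X f) - 4 * y (X f)" for f
    using c(2) by (simp add: defs l xs L22 L12 sym[symmetric] z_def field_simps del: mult_pCons_left mult_pCons_right)
  have B12: "left_mult L (F1_poly a c t0) 1 2 f + right_mult L (F1_poly a c t0) 1 2 f =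
     2 * (2 * a * c * z (X (X f)) - a * c * z f + 2 * z (X f))
     - 2 * a * (2 * y (X (X f)) - 3 * t0 * y (X f) + t0\<^sup>2 * y f)" for f
  proof -
    have "left_mult L (F1_poly a c t0) 1 2 f + right_mult L (F1_poly a c t0) 1 2 f =
       2 * (2 * a * c * l22 (X (X f)) - a * c * l22 f + 2 * l22 (X f)) +
       2 * (- a * y f + 2 * c * y (X f) + a * t0 * y (X f) - a * t0\<^sup>2 * y f)"
      by (simp add: defs l xs L22 L11 L12 yl power2_eq_square algebra_simps
          del: mult_pCons_left mult_pCons_right)
    also have "\<dots> = 2 * (2 * a * c * z (X (X f)) - a * c * z f + 2 * z (X f)) - 4 * a * y (X (X f))
       - 4 * (1 / c) * y (X f) + 4 * c * y (X f) + 2 * a * t0 * y (X f) - 2 * a * t0\<^sup>2 * y f"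
      using c(2) unfolding l22 by (simp add: field_simps)
    also have "1 / c = c - a * t0"
      using c by (simp add: power2_eq_square field_simps)
    finally show ?thesis by (simp add: algebra_simps)
  qed
  have I: "c * (- z (pderiv f) + 2 * z (X f)) = 2 * (y (X f) - t0 * y f)" for f
  proof -
    have "2 * (c * (- z (pderiv f) + 2 * z (X f))) = 2 * (2 * (y (X f) - t0 * y f))"
      using E2[of 2 2 f] B22[of f] A22[of "pderiv f"] by (simp add: algebra_simps)
    then show ?thesis unfolding mult_cancel_left by simp
  qed
  have y0: "y (X f) = t0 * y f" for f
  proof -
    define u where "u = y (X f) - t0 * y f"
    define v where "v = y (X (X f)) - t0 * y (X f)"
    have p: "pderiv (X f) = f + X (pderiv f)" by (simp add: X_def pderiv_pCons)
    \<comment> \<open>The \<open>(1,2)\<close> equation is \<open>z' + 2 t z\<close> tested on \<open>(1 + a c t) f\<close>; \<open>i1\<close> and \<open>i2\<close> eliminate \<open>z\<close> from it.\<close>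
    have i1: "- z (pderiv f) + 2 * z (X f) = 2 * u / c"
      using I[of f] c(2) by (simp add: u_def field_simps)
    have i2: "- z f - z (X (pderiv f)) + 2 * z (X (X f)) = 2 * v / c"
      using I[of "X f"] c(2) unfolding p by (simp add: v_def yl field_simps)
    have "2 * (- z (pderiv f) - a * c * z (X (pderiv f))) +
      (2 * (2 * a * c * z (X (X f)) - a * c * z f + 2 * z (X f))
       - 2 * a * (2 * y (X (X f)) - 3 * t0 * y (X f) + t0\<^sup>2 * y f)) = 0"
      using E2[of 1 2 f] B12[of f] A12[of "pderiv f"] by (simp add: algebra_simps)
    then have "2 * (- z (pderiv f) + 2 * z (X f)) + 2 * a * c * (- z f - z (X (pderiv f)) + 2 * z (X (X f)))
      = 2 * a * (2 * v - t0 * u)"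
      by (simp add: u_def v_def power2_eq_square algebra_simps)
    then have "2 * (2 * u / c) + 2 * a * c * (2 * v / c) = 2 * a * (2 * v - t0 * u)"
      unfolding i1 i2 .
    then have "2 * ((2 + a * c * t0) * u) = 2 * 0"
      using c(2) by (simp add: field_simps)
    then have "(2 + a * c * t0) * u = 0" unfolding mult_cancel_left by simp
    then show ?thesis using c(3) by (simp add: u_def)
  qed
  have y: "y p = y 1 * poly p t0" for p
    using vanishing_on_multiples[OF ylin(1)] y0 unfolding X_def by blast
  have z0: "z (pderiv f - [:0, 2:] * f) = 0" for f
  proof -
    have "[:0, 2:] * f = smult 2 (X f)" by (simp add: X_def)
    then have "c * z (pderiv f - [:0, 2:] * f) = - (c * (- z (pderiv f) + 2 * z (X f)))"
      by (simp only: yl) (simp add: algebra_simps)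
    then show ?thesis using I[of f] y0[of f] c(2) by simp
  qed
  have X1: "X 1 = [:0, 1:]" by (simp add: X_def one_pCons)
  have \<zeta>: "\<zeta> = - y 1 / c" unfolding \<zeta>_def y_def l22_def X1 ..
  have \<gamma>: "\<gamma> = z 1 / complex_of_real (sqrt pi)"
    unfolding \<gamma>_def z_def \<zeta> l22_def by simp
  have z: "z p = \<gamma> * gauss_functional p" for p
    using pearson_unique[OF ylin(3) z0] unfolding \<gamma> .
  have y': "y p = - c * \<zeta> * poly p t0" for p
    using y[of p] c(2) by (simp add: \<zeta>)
  have l: "l22 p = \<gamma> * gauss_functional p + \<zeta> * poly p t0" for p
    unfolding l22 y' z using c(2) by simp
  note gl = poly_functionalD[OF poly_functional_gauss]
  have pX: "poly (X p) t0 = t0 * poly p t0" for p by (simp add: X_def)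
  have g22: "L 2 2 p = \<gamma> * gauss_functional p + \<zeta> * poly p t0" for p
    unfolding L22 l ..
  have g12: "L 1 2 p = \<gamma> * a * gauss_functional (X p) + \<zeta> * (a * t0 - c) * poly p t0" for p
    unfolding L12 l y' pX by (simp add: algebra_simps)
  have g11: "L 1 1 p = \<gamma> * (gauss_functional p + a\<^sup>2 * gauss_functional (X (X p)))
     + \<zeta> * (a * t0 - c)\<^sup>2 * poly p t0" for p
  proof -
    have "(a * t0 - c)\<^sup>2 = a\<^sup>2 * t0\<^sup>2 - a * t0 * c + 1"
      using c(1) by (simp add: power2_eq_square algebra_simps)
    then show ?thesis
      unfolding L11 g12 l pX by (simp add: power2_eq_square algebra_simps)
  qed
  have "\<forall>i j. L i j = target_functional a (a * t0 - c) t0 \<gamma> \<zeta> i j"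
    unfolding forall_2 sym'[symmetric]
    by (auto simp: fun_eq_iff target_functional_def g11 g12 g22 weight_poly_def mass_matrix_def gl xs algebra_simps
        simp del: mult_pCons_left mult_pCons_right)
  then show "L i j = target_functional a (a * t0 - c) t0 \<gamma> \<zeta> i j" by blast
qed


lemma moment_equations_lincomb:
  assumes "moment_equations L F2 F1 F0" "moment_equations M F2 F1 F0"
  shows "moment_equations (\<lambda>i j p. \<gamma> * L i j p + \<zeta> * M i j p) F2 F1 F0"
proof -
  have lr: "left_mult (\<lambda>i j p. \<gamma> * L i j p + \<zeta> * M i j p) F i j f = \<gamma> * left_mult L F i j f + \<zeta> * left_mult M F i j f"
    "right_mult (\<lambda>i j p. \<gamma> * L i j p + \<zeta> * M i j p) F i j f = \<gamma> * right_mult L F i j f + \<zeta> * right_mult M F i j f"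
    for F i j f
    by (simp_all add: left_mult_def right_mult_def sum.distrib sum_distrib_left)
  have E1: "left_mult K F2 i j f = right_mult K F2 i j f"
    and E2: "2 * left_mult K F2 i j (pderiv f) + left_mult K F1 i j f + right_mult K F1 i j f = 0"
    and E3: "left_mult K F2 i j (pderiv (pderiv f)) + left_mult K F1 i j (pderiv f) +
        left_mult K (const_mpoly F0) i j f = right_mult K (const_mpoly F0) i j f"
    if "moment_equations K F2 F1 F0" for K i j f
    using that unfolding moment_equations_def by blast+
  show ?thesis
    unfolding moment_equations_def lr
  proof (intro allI conjI)
    fix i j f
    show "\<gamma> * left_mult L F2 i j f + \<zeta> * left_mult M F2 i j f =
      \<gamma> * right_mult L F2 i j f + \<zeta> * right_mult M F2 i j f"
      using assms by (simp only: E1)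
    have "2 * (\<gamma> * left_mult L F2 i j (pderiv f) + \<zeta> * left_mult M F2 i j (pderiv f)) +
       (\<gamma> * left_mult L F1 i j f + \<zeta> * left_mult M F1 i j f) +
       (\<gamma> * right_mult L F1 i j f + \<zeta> * right_mult M F1 i j f) =
       \<gamma> * (2 * left_mult L F2 i j (pderiv f) + left_mult L F1 i j f + right_mult L F1 i j f) +
       \<zeta> * (2 * left_mult M F2 i j (pderiv f) + left_mult M F1 i j f + right_mult M F1 i j f)"
      by (simp add: algebra_simps)
    then show "2 * (\<gamma> * left_mult L F2 i j (pderiv f) + \<zeta> * left_mult M F2 i j (pderiv f)) +
       (\<gamma> * left_mult L F1 i j f + \<zeta> * left_mult M F1 i j f) +
       (\<gamma> * right_mult L F1 i j f + \<zeta> * right_mult M F1 i j f) = 0"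
      using assms by (simp only: E2 mult_zero_right add_0)
    show "\<gamma> * left_mult L F2 i j (pderiv (pderiv f)) + \<zeta> * left_mult M F2 i j (pderiv (pderiv f)) +
       (\<gamma> * left_mult L F1 i j (pderiv f) + \<zeta> * left_mult M F1 i j (pderiv f)) +
       (\<gamma> * left_mult L (const_mpoly F0) i j f + \<zeta> * left_mult M (const_mpoly F0) i j f) =
       \<gamma> * right_mult L (const_mpoly F0) i j f + \<zeta> * right_mult M (const_mpoly F0) i j f"
      unfolding E3[OF assms(1), symmetric] E3[OF assms(2), symmetric] by (simp add: algebra_simps)
  qed
qed

text \<open>
  The derivative conjugated by the Gaussian: \<open>(p e\<^bsup>-t\<^sup>2\<^esup>)' = (weighted_deriv p) e\<^bsup>-t\<^sup>2\<^esup>\<close>.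
\<close>

definition weighted_deriv :: "complex poly \<Rightarrow> complex poly" where
  "weighted_deriv p = pderiv p - [:0, 2:] * p"

text \<open>
  Integration by parts reduces the moment equations for a density \<open>e\<^bsup>-t\<^sup>2\<^esup> V(t)\<close> with polynomial \<open>V\<close> to
  identities between polynomials.
\<close>

lemma moment_equations_gauss:
  fixes V :: "complex poly^'n::finite^'n"
  defines "FV \<equiv> \<lambda>F i j. \<Sum>k\<in>UNIV. F $ i $ k * V $ k $ j"
    and "VF \<equiv> \<lambda>F i j. \<Sum>k\<in>UNIV. F $ j $ k * V $ i $ k"
  assumes 1: "\<And>i j. FV F2 i j = VF F2 i j"
    and 2: "\<And>i j. FV F1 i j + VF F1 i j = smult 2 (weighted_deriv (FV F2 i j))"
    and 3: "\<And>i j. weighted_deriv (weighted_deriv (FV F2 i j)) - weighted_deriv (FV F1 i j) + FV (const_mpoly F0) i j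
      = VF (const_mpoly F0) i j"
  shows "moment_equations (\<lambda>i j p. gauss_functional (V $ i $ j * p)) F2 F1 F0"
proof -
  note g = poly_functionalD[OF poly_functional_gauss]
  have l: "left_mult (\<lambda>i j p. gauss_functional (V $ i $ j * p)) F i j f = gauss_functional (FV F i j * f)"
    "right_mult (\<lambda>i j p. gauss_functional (V $ i $ j * p)) F i j f = gauss_functional (VF F i j * f)" for F i j f
    unfolding left_mult_def right_mult_def FV_def VF_def sum_distrib_right poly_functional_sum[OF poly_functional_gauss]
    by (simp_all add: mult_ac)
  have parts: "gauss_functional (p * pderiv f) = - gauss_functional (weighted_deriv p * f)" for p f
    unfolding weighted_deriv_def by (rule gauss_functional_parts)
  show ?thesis
    unfolding moment_equations_def l parts
  proof (intro allI conjI)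
    fix i j f
    show "gauss_functional (FV F2 i j * f) = gauss_functional (VF F2 i j * f)" by (simp add: 1)
    have "gauss_functional ((FV F1 i j + VF F1 i j) * f) = 2 * gauss_functional (weighted_deriv (FV F2 i j) * f)"
      unfolding 2 by (simp add: g)
    then have "gauss_functional (FV F1 i j * f) + gauss_functional (VF F1 i j * f) =
      2 * gauss_functional (weighted_deriv (FV F2 i j) * f)"
      by (simp add: distrib_right g)
    then have "2 * - gauss_functional (weighted_deriv (FV F2 i j) * f) +
      (gauss_functional (FV F1 i j * f) + gauss_functional (VF F1 i j * f)) = 0"
      by simp
    then show "2 * - gauss_functional (weighted_deriv (FV F2 i j) * f) + gauss_functional (FV F1 i j * f) +
       gauss_functional (VF F1 i j * f) = 0"
      by (simp only: add.assoc)
    show "- (- gauss_functional (weighted_deriv (weighted_deriv (FV F2 i j)) * f)) +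
         - gauss_functional (weighted_deriv (FV F1 i j) * f) + gauss_functional (FV (const_mpoly F0) i j * f) =
         gauss_functional (VF (const_mpoly F0) i j * f)"
      unfolding 3[symmetric] by (simp add: algebra_simps g)
  qed
qed

lemma moment_equations_weight:
  assumes a: "a \<noteq> 0" and c: "c \<noteq> 0" and t0: "t0 = (c - 1 / c) / a"
  shows "moment_equations (\<lambda>i j p. gauss_functional (weight_poly a $ i $ j * p))
    (F2_poly a c t0) (F1_poly a c t0) (F0_const a c t0)"
proof -
  note defs = F2_poly_def F1_poly_def F0_const_def const_mpoly_def weight_poly_def weighted_deriv_def
    sum_2 pderiv_pCons pderiv_add pderiv_diff pderiv_smult pderiv_minus power2_eq_square
  have 1: "\<forall>i j. (\<Sum>k\<in>UNIV. F2_poly a c t0 $ i $ k * weight_poly a $ k $ j) =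
     (\<Sum>k\<in>UNIV. F2_poly a c t0 $ j $ k * weight_poly a $ i $ k)"
    unfolding forall_2 t0 using a c by (simp add: defs field_simps)
  have 2: "\<forall>i j. (\<Sum>k\<in>UNIV. F1_poly a c t0 $ i $ k * weight_poly a $ k $ j) +
     (\<Sum>k\<in>UNIV. F1_poly a c t0 $ j $ k * weight_poly a $ i $ k) =
     smult 2 (weighted_deriv (\<Sum>k\<in>UNIV. F2_poly a c t0 $ i $ k * weight_poly a $ k $ j))"
    unfolding forall_2 t0 using a c by (simp add: defs field_simps)
  have 3: "\<forall>i j. weighted_deriv (weighted_deriv (\<Sum>k\<in>UNIV. F2_poly a c t0 $ i $ k * weight_poly a $ k $ j)) -
     weighted_deriv (\<Sum>k\<in>UNIV. F1_poly a c t0 $ i $ k * weight_poly a $ k $ j) +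
     (\<Sum>k\<in>UNIV. const_mpoly (F0_const a c t0) $ i $ k * weight_poly a $ k $ j) =
     (\<Sum>k\<in>UNIV. const_mpoly (F0_const a c t0) $ j $ k * weight_poly a $ i $ k)"
    unfolding forall_2 t0 using a c by (simp add: defs field_simps)
  show ?thesis
    using 1 2 3 by (intro moment_equations_gauss) blast+
qed

text \<open>
  For the point mass the equations hold because \<open>F\<^sub>2(t\<^sub>0) M = 0\<close>, \<open>F\<^sub>1(t\<^sub>0) M = 0\<close> and \<open>F\<^sub>0 M\<close> is
  symmetric.
\<close>

lemma moment_equations_mass:
  assumes a: "a \<noteq> 0" and c: "c \<noteq> 0" and t0: "t0 = (c - 1 / c) / a"
  shows "moment_equations (\<lambda>i j p. mass_matrix (a * t0 - c) $ i $ j * poly p t0)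
    (F2_poly a c t0) (F1_poly a c t0) (F0_const a c t0)"
proof -
  have x: "a * t0 - c = - 1 / c" using a c by (simp add: t0 field_simps)
  note defs = left_mult_def right_mult_def F2_poly_def F1_poly_def F0_const_def const_mpoly_def
    mass_matrix_def sum_2 power2_eq_square
  have "left_mult (\<lambda>i j p. mass_matrix (a * t0 - c) $ i $ j * poly p t0) (F2_poly a c t0) i j f = 0 \<and>
    right_mult (\<lambda>i j p. mass_matrix (a * t0 - c) $ i $ j * poly p t0) (F2_poly a c t0) i j f = 0 \<and>
    left_mult (\<lambda>i j p. mass_matrix (a * t0 - c) $ i $ j * poly p t0) (F1_poly a c t0) i j f = 0 \<and>
    right_mult (\<lambda>i j p. mass_matrix (a * t0 - c) $ i $ j * poly p t0) (F1_poly a c t0) i j f = 0" for i j f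
    unfolding x using exhaust_2[of i] exhaust_2[of j] a c by (auto simp: defs t0 field_simps)
  moreover have "left_mult (\<lambda>i j p. mass_matrix (a * t0 - c) $ i $ j * poly p t0) (const_mpoly (F0_const a c t0)) i j f =
    right_mult (\<lambda>i j p. mass_matrix (a * t0 - c) $ i $ j * poly p t0) (const_mpoly (F0_const a c t0)) i j f" for i j f
    unfolding x using exhaust_2[of i] exhaust_2[of j] a c by (auto simp: defs t0 field_simps)
  ultimately show ?thesis by (simp add: moment_equations_def)
qed

theorem moment_equations_target:
  assumes a: "a \<noteq> 0" and c: "c \<noteq> 0" and c2: "c\<^sup>2 = a * t0 * c + 1"
  shows "moment_equations (target_functional a (a * t0 - c) t0 \<gamma> \<zeta>)
    (F2_poly a c t0) (F1_poly a c t0) (F0_const a c t0)"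
proof -
  have t0: "t0 = (c - 1 / c) / a" using a c c2 by (simp add: field_simps power2_eq_square)
  show ?thesis
    unfolding target_functional_def[abs_def]
    by (intro moment_equations_lincomb moment_equations_weight moment_equations_mass a c t0)
qed


section \<open>The measures with a Gaussian density and a point mass\<close>

lemma cmeasure_has_density:
  assumes d: "has_density \<nu> S g" and f: "f \<in> borel_measurable borel"
    and i: "integrable S (\<lambda>t. g t *\<^sub>R f t)"
  shows "finite_cmeasure (\<lambda>A. complex_of_real (\<nu> A))"
    "cmeasure_integrable (\<lambda>A. complex_of_real (\<nu> A)) f"
    "cmeasure_integral (\<lambda>A. complex_of_real (\<nu> A)) f = (LINT t|S. g t *\<^sub>R f t)"
proof -
  have "finite_signed (\<lambda>A. 0)" "signed_integrable (\<lambda>A. 0) f" "finite_signed \<nu>" "signed_integrable \<nu> f"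
    using zero_signed_measure[OF f] signed_integral_has_density(1)[OF d f] d i
    by (auto simp: finite_signed_def)
  then show "finite_cmeasure (\<lambda>A. complex_of_real (\<nu> A))"
    "cmeasure_integrable (\<lambda>A. complex_of_real (\<nu> A)) f"
    "cmeasure_integral (\<lambda>A. complex_of_real (\<nu> A)) f = (LINT t|S. g t *\<^sub>R f t)"
    using signed_integral_has_density(2)[OF d f]
    by (simp_all add: finite_cmeasure_def cmeasure_integrable_def cmeasure_integral_def)
qed

text \<open>
  The scalar measure \<open>t\<^sup>n e\<^bsup>-t\<^sup>2\<^esup> dt\<close>, with value \<open>0\<close> outside the Borel sets as required of the entries of
  a matrix of measures.
\<close>

definition gauss_part :: "nat \<Rightarrow> real set \<Rightarrow> real" where
  "gauss_part n \<Omega> = (if \<Omega> \<in> sets borel then LINT t:\<Omega>|lborel. exp (- t\<^sup>2) * t ^ n else 0)"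

text \<open>
  The Dirac measure at \<open>t\<^sub>0\<close>, with value \<open>0\<close> outside the Borel sets.
\<close>

definition dirac_part :: "real \<Rightarrow> real set \<Rightarrow> real" where
  "dirac_part t0 \<Omega> = (if \<Omega> \<in> sets borel then indicat_real \<Omega> t0 else 0)"

lemma has_density_gauss_part: "has_density (gauss_part n) lborel (\<lambda>t. exp (- t\<^sup>2) * t ^ n)"
  using gauss_moment_integrable[of n] by (simp add: has_density_def gauss_part_def)

lemma has_density_dirac_part: "has_density (dirac_part t0) (return borel t0) (\<lambda>_. 1)"
proof -
  interpret prob_space "return borel t0" by (rule prob_space_return) simp
  show ?thesis
    by (simp add: has_density_def dirac_part_def set_lebesgue_integral_def measure_return)
qed

text \<open>
  The matrix of measures \<open>\<gamma> W\<^sub>a + \<zeta> \<delta>\<^sub>t\<^sub>0 M\<close>.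
\<close>

definition target_measure :: "real \<Rightarrow> real \<Rightarrow> real \<Rightarrow> real \<Rightarrow> real \<Rightarrow> 2 matrix_measure" where
  "target_measure s a t0 \<gamma> \<zeta> =
     (\<lambda>\<Omega>. \<gamma> *\<^sub>R density_measure (W_density a) \<Omega> + \<zeta> *\<^sub>R dirac_measure t0 (M_mat s a t0) \<Omega>)"

lemma cmat2_nth [simp]:
  "cmat2 p q r u $ 1 $ 1 = complex_of_real p" "cmat2 p q r u $ 1 $ 2 = complex_of_real q"
  "cmat2 p q r u $ 2 $ 1 = complex_of_real r" "cmat2 p q r u $ 2 $ 2 = complex_of_real u"
  by (simp_all add: cmat2_def)

text \<open>
  Since \<open>W\<^sub>a\<close> is \<open>e\<^bsup>-t\<^sup>2\<^esup>\<close> times a quadratic polynomial with matrix coefficients, all its integrals reduce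
  to scalar ones.
\<close>

lemma density_measure_eq:
  "density_measure (W_density a) \<Omega> = gauss_part 0 \<Omega> *\<^sub>R cmat2 1 0 0 1 +
     gauss_part 1 \<Omega> *\<^sub>R cmat2 0 a a 0 + gauss_part 2 \<Omega> *\<^sub>R cmat2 (a\<^sup>2) 0 0 0"
proof (cases "\<Omega> \<in> sets borel")
  case True
  let ?h = "\<lambda>n t. indicat_real \<Omega> t *\<^sub>R (exp (- t\<^sup>2) * t ^ n)"
  have i: "integrable lborel (?h n)" for n
    using True gauss_moment_integrable[of n] by (intro integrable_mult_indicator) auto
  have "indicat_real \<Omega> t *\<^sub>R W_density a t =
     ?h 0 t *\<^sub>R cmat2 1 0 0 1 + ?h 1 t *\<^sub>R cmat2 0 a a 0 + ?h 2 t *\<^sub>R cmat2 (a\<^sup>2) 0 0 0" for t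
    unfolding vec_eq_iff forall_2 W_density_def
    by (simp add: scaleR_conv_of_real[where 'a = complex] algebra_simps)
  then have "(LINT t:\<Omega>|lborel. W_density a t) = (LINT t|lborel.
     ?h 0 t *\<^sub>R cmat2 1 0 0 1 + ?h 1 t *\<^sub>R cmat2 0 a a 0 + ?h 2 t *\<^sub>R cmat2 (a\<^sup>2) 0 0 0)"
    unfolding set_lebesgue_integral_def by (simp only:)
  also have "\<dots> = (LINT t|lborel. ?h 0 t) *\<^sub>R cmat2 1 0 0 1 + (LINT t|lborel. ?h 1 t) *\<^sub>R cmat2 0 a a 0 +
      (LINT t|lborel. ?h 2 t) *\<^sub>R cmat2 (a\<^sup>2) 0 0 0"
    by (simp only: i Bochner_Integration.integral_add Bochner_Integration.integrable_add
        integrable_scaleR_left integral_scaleR_left)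
  finally show ?thesis
    using True by (simp add: density_measure_def gauss_part_def set_lebesgue_integral_def)
next
  case False
  then show ?thesis by (simp add: density_measure_def gauss_part_def)
qed

lemma dirac_measure_eq: "dirac_measure t0 M \<Omega> = dirac_part t0 \<Omega> *\<^sub>R M"
  by (simp add: dirac_measure_def dirac_part_def)

lemma target_measure_eq:
  "target_measure s a t0 \<gamma> \<zeta> \<Omega> = gauss_part 0 \<Omega> *\<^sub>R (\<gamma> *\<^sub>R cmat2 1 0 0 1) +
     gauss_part 1 \<Omega> *\<^sub>R (\<gamma> *\<^sub>R cmat2 0 a a 0) + gauss_part 2 \<Omega> *\<^sub>R (\<gamma> *\<^sub>R cmat2 (a\<^sup>2) 0 0 0) +
     dirac_part t0 \<Omega> *\<^sub>R (\<zeta> *\<^sub>R M_mat s a t0)"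
  unfolding target_measure_def density_measure_eq dirac_measure_eq
  by (simp add: scaleR_add_right mult.commute)

lemma is_matrix_measure_target: "is_matrix_measure (target_measure s a t0 \<gamma> \<zeta>)"
proof -
  have fs: "finite_signed (gauss_part n)" "finite_signed (dirac_part t0)" for n
    using has_density_gauss_part has_density_dirac_part by (auto simp: finite_signed_def)
  show ?thesis
    unfolding is_matrix_measure_def target_measure_eq
  proof (intro conjI allI impI)
    fix \<Omega> :: "real set"
    assume "\<Omega> \<notin> sets borel"
    then show "gauss_part 0 \<Omega> *\<^sub>R (\<gamma> *\<^sub>R cmat2 1 0 0 1) +
     gauss_part 1 \<Omega> *\<^sub>R (\<gamma> *\<^sub>R cmat2 0 a a 0) + gauss_part 2 \<Omega> *\<^sub>R (\<gamma> *\<^sub>R cmat2 (a\<^sup>2) 0 0 0) +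
     dirac_part t0 \<Omega> *\<^sub>R (\<zeta> *\<^sub>R M_mat s a t0) = 0"
      by (simp add: gauss_part_def dirac_part_def)
  qed (intro sums_add bounded_linear.sums[OF bounded_linear_scaleR_left] finite_signed_sums fs)
qed

lemma pos_semidef_target:
  assumes "0 \<le> \<gamma>" "0 \<le> \<zeta>" and \<Omega>: "\<Omega> \<in> sets borel"
  shows "pos_semidef (target_measure s a t0 \<gamma> \<zeta> \<Omega>)"
proof -
  define x where "x = xi s a t0"
  define h where "h n t = indicat_real \<Omega> t *\<^sub>R (exp (- t\<^sup>2) * t ^ n)" for n t
  have i: "integrable lborel (h n)" for n
    unfolding h_def using \<Omega> gauss_moment_integrable[of n] by (intro integrable_mult_indicator) auto
  have g: "gauss_part n \<Omega> = (LINT t|lborel. h n t)" for n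
    using \<Omega> by (simp add: gauss_part_def h_def set_lebesgue_integral_def)
  have M: "M_mat s a t0 = cmat2 (x\<^sup>2) x x 1" by (simp add: M_mat_def x_def)
  have "0 \<le> Re (\<Sum>i\<in>UNIV. \<Sum>j\<in>UNIV. cnj (v $ i) * target_measure s a t0 \<gamma> \<zeta> \<Omega> $ i $ j * v $ j)" for v
  proof -
    let ?u = "v $ 1" and ?w = "v $ 2"
    define q0 q1 q2 where "q0 = (cmod ?u)\<^sup>2 + (cmod ?w)\<^sup>2" and "q1 = 2 * a * Re (cnj ?u * ?w)"
      and "q2 = a\<^sup>2 * (cmod ?u)\<^sup>2"
    have n: "cnj z * z = complex_of_real ((cmod z)\<^sup>2)" for z
      by (simp add: complex_norm_square mult.commute del: of_real_power)
    have "Re (\<Sum>i\<in>UNIV. \<Sum>j\<in>UNIV. cnj (v $ i) * target_measure s a t0 \<gamma> \<zeta> \<Omega> $ i $ j * v $ j) =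
      \<gamma> * (gauss_part 0 \<Omega> * q0 + gauss_part 1 \<Omega> * q1 + gauss_part 2 \<Omega> * q2) +
      \<zeta> * dirac_part t0 \<Omega> * (cmod (complex_of_real x * ?u + ?w))\<^sup>2"
      unfolding target_measure_eq M sum_2 q0_def q1_def q2_def cmod_power2
      by (simp add: scaleR_conv_of_real[where 'a = complex] power2_eq_square algebra_simps)
    moreover have "gauss_part 0 \<Omega> * q0 + gauss_part 1 \<Omega> * q1 + gauss_part 2 \<Omega> * q2 =
       (LINT t|lborel. h 0 t * q0 + h 1 t * q1 + h 2 t * q2)"
      unfolding g using i by simp
    moreover have "0 \<le> h 0 t * q0 + h 1 t * q1 + h 2 t * q2" for t
    proof -
      have "h 0 t * q0 + h 1 t * q1 + h 2 t * q2 =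
        indicat_real \<Omega> t * exp (- t\<^sup>2) * ((cmod ?u)\<^sup>2 + (cmod (complex_of_real (a * t) * ?u + ?w))\<^sup>2)"
        unfolding h_def q0_def q1_def q2_def cmod_power2
        by (simp add: power2_eq_square algebra_simps)
      then show ?thesis by simp
    qed
    ultimately show ?thesis
      using assms by (simp add: dirac_part_def)
  qed
  moreover have "conj_transpose (target_measure s a t0 \<gamma> \<zeta> \<Omega>) = target_measure s a t0 \<gamma> \<zeta> \<Omega>"
    unfolding vec_eq_iff forall_2 conj_transpose_def target_measure_eq M
    by (simp add: scaleR_conv_of_real[where 'a = complex])
  ultimately show ?thesis by (simp add: pos_semidef_def)
qed

lemma psd_measure_target:
  assumes "0 \<le> \<gamma>" "0 \<le> \<zeta>" shows "psd_measure (target_measure s a t0 \<gamma> \<zeta>)"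
  using assms by (simp add: psd_measure_def is_matrix_measure_target pos_semidef_target)

lemma target_measure_integral:
  assumes f: "f \<in> borel_measurable borel"
    and i: "\<And>n. integrable lborel (\<lambda>t. (exp (- t\<^sup>2) * t ^ n) *\<^sub>R f t)"
  defines "I \<equiv> \<lambda>n. LINT t|lborel. (exp (- t\<^sup>2) * t ^ n) *\<^sub>R f t"
  shows "cmeasure_integrable (\<lambda>\<Omega>. target_measure s a t0 \<gamma> \<zeta> \<Omega> $ k $ l) f"
    "cmeasure_integral (\<lambda>\<Omega>. target_measure s a t0 \<gamma> \<zeta> \<Omega> $ k $ l) f =
       \<gamma> * (cmat2 1 0 0 1 $ k $ l * I 0 + cmat2 0 a a 0 $ k $ l * I 1 + cmat2 (a\<^sup>2) 0 0 0 $ k $ l * I 2) +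
       \<zeta> * (M_mat s a t0 $ k $ l * f t0)"
proof -
  have e: "(\<lambda>\<Omega>. target_measure s a t0 \<gamma> \<zeta> \<Omega> $ k $ l) = (\<lambda>\<Omega>.
     (\<gamma> * cmat2 1 0 0 1 $ k $ l) * complex_of_real (gauss_part 0 \<Omega>) +
     (\<gamma> * cmat2 0 a a 0 $ k $ l) * complex_of_real (gauss_part 1 \<Omega>) +
     (\<gamma> * cmat2 (a\<^sup>2) 0 0 0 $ k $ l) * complex_of_real (gauss_part 2 \<Omega>) +
     (\<zeta> * M_mat s a t0 $ k $ l) * complex_of_real (dirac_part t0 \<Omega>))"
    unfolding target_measure_eq by (simp add: fun_eq_iff scaleR_conv_of_real[where 'a = complex] mult_ac)
  note g = cmeasure_has_density[OF has_density_gauss_part f i]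
  have "f \<in> borel_measurable (return borel t0)" using f by (simp cong: measurable_cong_sets)
  then have ir: "integrable (return borel t0) (\<lambda>t. 1 *\<^sub>R f t)" "(LINT t|return borel t0. 1 *\<^sub>R f t) = f t0"
    using f by (auto simp: integral_return nn_integral_return intro!: integrableI_bounded)
  note d = cmeasure_has_density[OF has_density_dirac_part f ir(1), unfolded ir(2)]
  note fin = finite_cmeasure_add finite_cmeasure_cmult g(1) d(1)
  note int = cmeasure_add(1) cmeasure_cmult(1) g(2) d(2) f
  show "cmeasure_integrable (\<lambda>\<Omega>. target_measure s a t0 \<gamma> \<zeta> \<Omega> $ k $ l) f"
    unfolding e by (intro int fin)
  show "cmeasure_integral (\<lambda>\<Omega>. target_measure s a t0 \<gamma> \<zeta> \<Omega> $ k $ l) f =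
       \<gamma> * (cmat2 1 0 0 1 $ k $ l * I 0 + cmat2 0 a a 0 $ k $ l * I 1 + cmat2 (a\<^sup>2) 0 0 0 $ k $ l * I 2) +
       \<zeta> * (M_mat s a t0 $ k $ l * f t0)"
    unfolding e
    by (simp add: cmeasure_add(2) cmeasure_cmult(2) int fin g(3) d(3) I_def distrib_left)
qed

lemma M_mat_eq_mass_matrix: "M_mat s a t0 = mass_matrix (complex_of_real (xi s a t0))"
  unfolding vec_eq_iff forall_2 M_mat_def mass_matrix_def by simp

lemma target_measure_poly:
  shows "cmeasure_integrable (\<lambda>\<Omega>. target_measure s a t0 \<gamma> \<zeta> \<Omega> $ k $ l) (\<lambda>t. poly p (complex_of_real t))"
    "moment_functional (target_measure s a t0 \<gamma> \<zeta>) k l p =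
       target_functional a (xi s a t0) t0 \<gamma> \<zeta> k l p"
proof -
  have e: "(exp (- t\<^sup>2) * t ^ n) *\<^sub>R poly p (complex_of_real t) =
     exp (- t\<^sup>2) *\<^sub>R poly (monom 1 n * p) (complex_of_real t)" for n t
    by (simp add: poly_monom scaleR_conv_of_real[where 'a = complex])
  have i: "integrable lborel (\<lambda>t. (exp (- t\<^sup>2) * t ^ n) *\<^sub>R poly p (complex_of_real t))" for n
    unfolding e by (rule gauss_integrable_poly)
  note t = target_measure_integral[OF poly_of_real_measurable i, of s a t0 \<gamma> \<zeta> k l]
  show "cmeasure_integrable (\<lambda>\<Omega>. target_measure s a t0 \<gamma> \<zeta> \<Omega> $ k $ l) (\<lambda>t. poly p (complex_of_real t))"
    by (rule t)
  note gl = poly_functionalD[OF poly_functional_gauss]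
  have "\<forall>k l. gauss_functional (weight_poly a $ k $ l * p) =
     cmat2 1 0 0 1 $ k $ l * gauss_functional (monom 1 0 * p) +
     cmat2 0 a a 0 $ k $ l * gauss_functional (monom 1 1 * p) +
     cmat2 (a\<^sup>2) 0 0 0 $ k $ l * gauss_functional (monom 1 2 * p)"
  proof -
    have m: "monom (1::complex) 0 = 1" "monom (1::complex) 1 = [:0, 1:]" "monom (1::complex) 2 = [:0, 0, 1:]"
      by (simp_all add: monom_0 monom_Suc numeral_2_eq_2 one_pCons)
    have w: "weight_poly a $ k $ l = smult (cmat2 1 0 0 1 $ k $ l) 1 +
      smult (cmat2 0 a a 0 $ k $ l) [:0, 1:] + smult (cmat2 (a\<^sup>2) 0 0 0 $ k $ l) [:0, 0, 1:]" for k l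
      using exhaust_2[of k] exhaust_2[of l] by (auto simp: weight_poly_def one_pCons)
    show ?thesis unfolding m w by (simp only: distrib_right mult_smult_left gl)  simp
  qed
  then show "moment_functional (target_measure s a t0 \<gamma> \<zeta>) k l p =
       target_functional a (xi s a t0) t0 \<gamma> \<zeta> k l p"
    unfolding moment_functional_def t(2) target_functional_def e M_mat_eq_mass_matrix
    by (simp add: gauss_functional_def)
qed

lemma target_measure_exp_integrable:
  "cmeasure_integrable (\<lambda>\<Omega>. target_measure s a t0 \<gamma> \<zeta> \<Omega> $ k $ l) (\<lambda>t. complex_of_real (exp (c * t)))"
proof (rule target_measure_integral(1))
  show "(\<lambda>t. complex_of_real (exp (c * t))) \<in> borel_measurable borel" by measurable
  show "integrable lborel (\<lambda>t. (exp (- t\<^sup>2) * t ^ n) *\<^sub>R complex_of_real (exp (c * t)))" for n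
    using gauss_exp_integrable_poly[of c "monom 1 n"]
    by (simp add: poly_monom scaleR_conv_of_real[where 'a = complex] mult_ac)
qed

lemma finite_moments_target: "finite_moments (target_measure s a t0 \<gamma> \<zeta>)"
  using target_measure_poly(1)[of s a t0 \<gamma> \<zeta> _ _ "monom 1 _"]
  by (simp add: finite_moments_def poly_monom)


section \<open>Weight matrices for which the operator is symmetric\<close>

lemma psd_measure_add:
  assumes "psd_measure W" "psd_measure V" shows "psd_measure (\<lambda>\<Omega>. W \<Omega> + V \<Omega>)"
proof -
  have "is_matrix_measure (\<lambda>\<Omega>. W \<Omega> + V \<Omega>)"
    using assms by (auto simp: psd_measure_def is_matrix_measure_def intro!: sums_add)
  moreover have "pos_semidef (W \<Omega> + V \<Omega>)" if "\<Omega> \<in> sets borel" for \<Omega>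
  proof -
    have "pos_semidef (W \<Omega>)" "pos_semidef (V \<Omega>)" using assms that by (auto simp: psd_measure_def)
    then show ?thesis
      by (auto simp: pos_semidef_def conj_transpose_def vec_eq_iff distrib_left distrib_right sum.distrib)
  qed
  ultimately show ?thesis by (simp add: psd_measure_def)
qed

lemma moment_functional_add:
  assumes "psd_measure W" "psd_measure V" "finite_moments W" "finite_moments V"
  shows "finite_moments (\<lambda>\<Omega>. W \<Omega> + V \<Omega>)"
    "moment_functional (\<lambda>\<Omega>. W \<Omega> + V \<Omega>) k l p = moment_functional W k l p + moment_functional V k l p"
proof -
  note f = assms(1,2)[THEN psd_measure_finite_cmeasure]
  have i: "cmeasure_integrable (\<lambda>\<Omega>. W \<Omega> $ k $ l) (\<lambda>t. poly p (complex_of_real t))"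
    "cmeasure_integrable (\<lambda>\<Omega>. V \<Omega> $ k $ l) (\<lambda>t. poly p (complex_of_real t))" for k l p
    using assms(3,4) by (auto simp: finite_moments_def intro!: cmeasure_integrable_poly f)
  note add = cmeasure_add[OF f poly_of_real_measurable i]
  show "finite_moments (\<lambda>\<Omega>. W \<Omega> + V \<Omega>)"
    unfolding finite_moments_def
  proof (intro allI)
    fix n i j
    have "cmeasure_integrable (\<lambda>\<Omega>. W \<Omega> $ i $ j + V \<Omega> $ i $ j) (\<lambda>t. poly (monom 1 n) (complex_of_real t))"
      by (rule add(1))
    then show "cmeasure_integrable (\<lambda>\<Omega>. (W \<Omega> + V \<Omega>) $ i $ j) (\<lambda>t. complex_of_real (t ^ n))"
      by (simp add: poly_monom)
  qed
  show "moment_functional (\<lambda>\<Omega>. W \<Omega> + V \<Omega>) k l p = moment_functional W k l p + moment_functional V k l p"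
    using add(2) by (simp add: moment_functional_def)
qed

lemma psd_measure_eqI_moments:
  assumes psd: "psd_measure W" "psd_measure V" and fm: "finite_moments W" "finite_moments V"
    and eq: "\<And>k l n. moment_functional W k l (monom 1 n) = moment_functional V k l (monom 1 n)"
    and ex: "\<And>k l c. cmeasure_integrable (\<lambda>\<Omega>. V \<Omega> $ k $ l) (\<lambda>t. complex_of_real (exp (c * t)))"
  shows "W = V"
proof (rule psd_measure_eqI[OF psd])
  fix v A
  obtain M where M: "finite_measure M" "sets M = sets borel" "quad_form W v = (\<lambda>A. complex_of_real (measure M A))"
    using psd_measure_quad_form[OF psd(1)] by blast
  obtain N where N: "finite_measure N" "sets N = sets borel" "quad_form V v = (\<lambda>A. complex_of_real (measure N A))"
    using psd_measure_quad_form[OF psd(2)] by blast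
  have meas: "(\<lambda>t. complex_of_real (t ^ n)) \<in> borel_measurable borel"
    "(\<lambda>t. complex_of_real (exp (c * t))) \<in> borel_measurable borel" for n c
    by measurable
  have e: "cmeasure_integral (\<lambda>\<Omega>. W \<Omega> $ k $ l) (\<lambda>t. complex_of_real (t ^ n)) =
     cmeasure_integral (\<lambda>\<Omega>. V \<Omega> $ k $ l) (\<lambda>t. complex_of_real (t ^ n))" for k l n
    using eq[of k l n] by (simp add: moment_functional_def poly_monom)
  note qW = quad_form_integral[OF psd(1) meas(1), of _ v] and qV = quad_form_integral[OF psd(2) meas(1), of _ v]
  have iW: "cmeasure_integrable (quad_form W v) (\<lambda>t. complex_of_real (t ^ n))"
    and iV: "cmeasure_integrable (quad_form V v) (\<lambda>t. complex_of_real (t ^ n))" for n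
    using fm qW(1) qV(1) by (auto simp: finite_moments_def)
  have iE: "cmeasure_integrable (quad_form V v) (\<lambda>t. complex_of_real (exp (c * t)))" for c
    using ex by (intro quad_form_integral[OF psd(2) meas(2)]) auto
  have eqI: "cmeasure_integral (quad_form W v) (\<lambda>t. complex_of_real (t ^ n)) =
    cmeasure_integral (quad_form V v) (\<lambda>t. complex_of_real (t ^ n))" for n
    using fm by (subst qW(2), simp add: finite_moments_def, subst qV(2), simp add: finite_moments_def, simp only: e)
  note cM = cmeasure_of_measure[OF M(1,2), folded M(3)]
  note cN = cmeasure_of_measure[OF N(1,2), folded N(3)]
  have "M = N"
  proof (rule finite_measure_eqI_moments[OF M(1) N(1) M(2) N(2)])
    show "integrable M (\<lambda>t. t ^ n)" for n
      using iW[of n] cM(2)[OF meas(1)[of n]] unfolding complex_of_real_integrable_eq by simp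
    show "integrable N (\<lambda>t. t ^ n)" for n
      using iV[of n] cN(2)[OF meas(1)[of n]] unfolding complex_of_real_integrable_eq by simp
    show "(LINT t|M. t ^ n) = (LINT t|N. t ^ n)" for n
      using eqI[of n] cM(3)[OF meas(1) iW[of n]] cN(3)[OF meas(1) iV[of n]]
      by (simp only: integral_complex_of_real of_real_eq_iff)
    show "integrable N (\<lambda>t. exp (c * t))" for c
      using iE[of c] cN(2)[OF meas(2)[of c]] unfolding complex_of_real_integrable_eq by simp
  qed
  then show "quad_form W v A = quad_form V v A" using M(3) N(3) by simp
qed

lemma xi_relations:
  assumes "s \<in> {1, - 1}"
  shows "xi s a t0 = a * t0 - xi (- s) a t0" "(xi (- s) a t0)\<^sup>2 = a * t0 * xi (- s) a t0 + 1"
    "xi (- s) a t0 \<noteq> 0" "2 + a * xi (- s) a t0 * t0 \<noteq> 0"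
proof -
  let ?c = "xi (- s) a t0"
  show "xi s a t0 = a * t0 - ?c" by (simp add: xi_def field_simps)
  have s2: "s\<^sup>2 = 1" using assms by auto
  have r: "(sqrt (4 + a\<^sup>2 * t0\<^sup>2))\<^sup>2 = 4 + a\<^sup>2 * t0\<^sup>2" by simp
  have "(2 * ?c - a * t0)\<^sup>2 = s\<^sup>2 * (sqrt (4 + a\<^sup>2 * t0\<^sup>2))\<^sup>2"
  proof -
    have "2 * ?c - a * t0 = - s * sqrt (4 + a\<^sup>2 * t0\<^sup>2)" by (simp add: xi_def field_simps)
    then show ?thesis by (simp add: power_mult_distrib)
  qed
  also have "\<dots> = 4 + a\<^sup>2 * t0\<^sup>2" unfolding s2 r by simp
  finally show c2: "?c\<^sup>2 = a * t0 * ?c + 1"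
    by (simp add: power2_eq_square algebra_simps)
  show "?c \<noteq> 0" using c2 by auto
  have "2 + a * ?c * t0 = ?c\<^sup>2 + 1" using c2 by (simp add: mult_ac)
  then show "2 + a * ?c * t0 \<noteq> 0" by (smt (verit) zero_le_power2)
qed

lemma D_op_eq:
  "D_op s a t0 = diff_op
     (mpoly_eval (F2_poly (complex_of_real a) (complex_of_real (xi (- s) a t0)) (complex_of_real t0)))
     (mpoly_eval (F1_poly (complex_of_real a) (complex_of_real (xi (- s) a t0)) (complex_of_real t0)))
     (F0_const (complex_of_real a) (complex_of_real (xi (- s) a t0)) (complex_of_real t0))"
proof -
  have "F2_mat s a t0 t = mpoly_eval (F2_poly a (xi (- s) a t0) t0) t"
    "F1_mat s a t0 t = mpoly_eval (F1_poly a (xi (- s) a t0) t0) t"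
    "F0_mat s a t0 = F0_const a (xi (- s) a t0) t0" for t
    unfolding vec_eq_iff forall_2
    by (simp_all add: F2_mat_def F1_mat_def F0_mat_def F2_poly_def F1_poly_def F0_const_def mpoly_eval_def
        power2_eq_square algebra_simps)
  then show ?thesis unfolding D_op_def by (metis ext)
qed

lemma symmetric_wrt_D_op_iff:
  assumes "psd_measure W" "finite_moments W"
  shows "symmetric_wrt (D_op s a t0) W \<longleftrightarrow> moment_equations (moment_functional W)
     (F2_poly (complex_of_real a) (complex_of_real (xi (- s) a t0)) (complex_of_real t0))
     (F1_poly (complex_of_real a) (complex_of_real (xi (- s) a t0)) (complex_of_real t0))
     (F0_const (complex_of_real a) (complex_of_real (xi (- s) a t0)) (complex_of_real t0))"
  unfolding D_op_eq
proof (rule symmetric_wrt_iff_moment_equations[OF assms])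
  fix i k :: 2
  show "cnj_poly (F2_poly (complex_of_real a) (complex_of_real (xi (- s) a t0)) (complex_of_real t0) $ i $ k) =
    F2_poly (complex_of_real a) (complex_of_real (xi (- s) a t0)) (complex_of_real t0) $ i $ k"
    "cnj_poly (F1_poly (complex_of_real a) (complex_of_real (xi (- s) a t0)) (complex_of_real t0) $ i $ k) =
    F1_poly (complex_of_real a) (complex_of_real (xi (- s) a t0)) (complex_of_real t0) $ i $ k"
    "cnj (F0_const (complex_of_real a) (complex_of_real (xi (- s) a t0)) (complex_of_real t0) $ i $ k) =
    F0_const (complex_of_real a) (complex_of_real (xi (- s) a t0)) (complex_of_real t0) $ i $ k"
    using exhaust_2[of i] exhaust_2[of k]
    by (auto simp: F2_poly_def F1_poly_def F0_const_def map_poly_pCons)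
qed

lemma weight_matrix_iff:
  "weight_matrix W \<longleftrightarrow> psd_measure W \<and> finite_moments W \<and>
    (\<forall>P. invertible (mpoly_lead_coeff P) \<longrightarrow>
        invertible (sandwich_integral (mpoly_eval P) W (mpoly_eval P)))"
  by (auto simp: weight_matrix_def psd_measure_def finite_moments_def)

text \<open>
  For a row \<open>p\<close> the square \<open>\<integral> p dW p\<^sup>*\<close> equals \<open>\<gamma> \<integral> (\<bar>p\<^sub>1\<bar>\<^sup>2 + \<bar>a t p\<^sub>1 + p\<^sub>2\<bar>\<^sup>2) e\<^bsup>-t\<^sup>2\<^esup> dt + \<zeta> \<bar>w\<bar>\<^sup>2\<close> with
  \<open>w = x p\<^sub>1(t\<^sub>0) + p\<^sub>2(t\<^sub>0)\<close>, so it vanishes only for \<open>p = 0\<close>.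
\<close>

lemma target_functional_square:
  fixes p :: "2 \<Rightarrow> complex poly"
  assumes "\<gamma> > 0" "\<zeta> \<ge> 0"
    and 0: "(\<Sum>k\<in>UNIV. \<Sum>l\<in>UNIV. target_functional (complex_of_real a) (complex_of_real x) (complex_of_real t0)
      (complex_of_real \<gamma>) (complex_of_real \<zeta>) k l (p k * cnj_poly (p l))) = 0"
  shows "p k = 0"
proof -
  define r where "r = [:0, complex_of_real a:] * p 1 + p 2"
  define w where "w = complex_of_real x * poly (p 1) (complex_of_real t0) + poly (p 2) (complex_of_real t0)"
  have cr: "cnj_poly r = [:0, complex_of_real a:] * cnj_poly (p 1) + cnj_poly (p 2)"
    unfolding r_def by (simp add: map_poly_pCons del: mult_pCons_left)
  note gl = poly_functionalD[OF poly_functional_gauss]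
  have poly_id: "weight_poly a $ 1 $ 1 * (p 1 * cnj_poly (p 1)) + weight_poly a $ 1 $ 2 * (p 1 * cnj_poly (p 2)) +
      (weight_poly a $ 2 $ 1 * (p 2 * cnj_poly (p 1)) + weight_poly a $ 2 $ 2 * (p 2 * cnj_poly (p 2))) =
     p 1 * cnj_poly (p 1) + r * cnj_poly r"
  proof -
    have w: "weight_poly a $ 1 $ 1 = 1 + [:0, complex_of_real a:] * [:0, complex_of_real a:]"
      "weight_poly a $ 1 $ 2 = [:0, complex_of_real a:]" "weight_poly a $ 2 $ 1 = [:0, complex_of_real a:]"
      "weight_poly a $ 2 $ 2 = 1"
      by (simp_all add: weight_poly_def power2_eq_square one_pCons)
    show ?thesis unfolding w cr unfolding r_def
      by (simp only: distrib_left distrib_right mult_1_left mult_ac add_ac)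
  qed
  have "(\<Sum>k\<in>UNIV. \<Sum>l\<in>UNIV. target_functional (complex_of_real a) (complex_of_real x) (complex_of_real t0)
      (complex_of_real \<gamma>) (complex_of_real \<zeta>) k l (p k * cnj_poly (p l))) =
    \<gamma> * gauss_functional (weight_poly a $ 1 $ 1 * (p 1 * cnj_poly (p 1)) + weight_poly a $ 1 $ 2 * (p 1 * cnj_poly (p 2)) +
      (weight_poly a $ 2 $ 1 * (p 2 * cnj_poly (p 1)) + weight_poly a $ 2 $ 2 * (p 2 * cnj_poly (p 2)))) +
    \<zeta> * (w * cnj w)"
    unfolding sum_2 target_functional_def gl(1) w_def
    by (simp add: mass_matrix_def power2_eq_square algebra_simps)
  also have "\<dots> = \<gamma> * (gauss_functional (p 1 * cnj_poly (p 1)) + gauss_functional (r * cnj_poly r)) +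
     \<zeta> * complex_of_real ((cmod w)\<^sup>2)"
    unfolding poly_id gl(1) complex_norm_square ..
  finally have "Re (\<gamma> * (gauss_functional (p 1 * cnj_poly (p 1)) + gauss_functional (r * cnj_poly r)) +
     \<zeta> * complex_of_real ((cmod w)\<^sup>2)) = 0"
    using 0 by simp
  then have "\<gamma> * (Re (gauss_functional (p 1 * cnj_poly (p 1))) + Re (gauss_functional (r * cnj_poly r))) +
     \<zeta> * (cmod w)\<^sup>2 = 0"
    by (simp del: of_real_power)
  moreover have "0 \<le> Re (gauss_functional (p 1 * cnj_poly (p 1)))" "0 \<le> Re (gauss_functional (r * cnj_poly r))"
    "0 \<le> \<zeta> * (cmod w)\<^sup>2"
    using gauss_functional_square(2) assms(2) by auto
  ultimately have "Re (gauss_functional (p 1 * cnj_poly (p 1))) = 0" "Re (gauss_functional (r * cnj_poly r)) = 0"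
    using \<open>\<gamma> > 0\<close> by (smt (verit) mult_pos_pos)+
  then have "gauss_functional (p 1 * cnj_poly (p 1)) = 0" "gauss_functional (r * cnj_poly r) = 0"
    using gauss_functional_square(1) by (auto simp: complex_eq_iff)
  then have "p 1 = 0" "r = 0"
    using gauss_functional_square(3) by blast+
  then show ?thesis using exhaust_2[of k] by (auto simp: r_def)
qed

lemma weight_matrix_target:
  assumes "\<gamma> > 0" "\<zeta> \<ge> 0"
  shows "weight_matrix (target_measure s a t0 \<gamma> \<zeta>)"
  unfolding weight_matrix_iff
proof (intro conjI allI impI)
  let ?V = "target_measure s a t0 \<gamma> \<zeta>"
  let ?T = "target_functional (complex_of_real a) (complex_of_real (xi s a t0)) (complex_of_real t0)
      (complex_of_real \<gamma>) (complex_of_real \<zeta>)"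
  show psd: "psd_measure ?V" using assms by (intro psd_measure_target) auto
  show fm: "finite_moments ?V" by (rule finite_moments_target)
  have L: "moment_functional ?V = ?T" by (simp add: fun_eq_iff target_measure_poly(2))
  have lin: "poly_functional (?T k l)" for k l
    unfolding L[symmetric] by (rule poly_functional_moment_functional[OF psd fm])
  note l = poly_functionalD[OF lin]
  fix P :: "complex poly^2^2"
  assume P: "invertible (mpoly_lead_coeff P)"
  let ?S = "sandwich_integral (mpoly_eval P) ?V (mpoly_eval P)"
  have S: "?S $ i $ j = (\<Sum>k\<in>UNIV. \<Sum>l\<in>UNIV. ?T k l (P $ i $ k * cnj_poly (P $ j $ l)))" for i j
    unfolding L[symmetric] by (rule sandwich_integral_poly) (simp_all add: mpoly_eval_def)
  show "invertible ?S"
    unfolding invertible_left_inverse matrix_left_invertible_ker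
  proof (intro allI impI)
    fix y assume "?S *v y = 0"
    then have y: "(\<Sum>j\<in>UNIV. ?S $ i $ j * y $ j) = 0" for i
      by (auto simp: matrix_vector_mult_def vec_eq_iff)
    define p where "p k = (\<Sum>i\<in>UNIV. smult (cnj (y $ i)) (P $ i $ k))" for k
    have cp: "cnj_poly (p k) = (\<Sum>i\<in>UNIV. smult (y $ i) (cnj_poly (P $ i $ k)))" for k
      by (simp add: p_def cnj_poly_sum)
    have "(\<Sum>k\<in>UNIV. \<Sum>l\<in>UNIV. ?T k l (p k * cnj_poly (p l))) =
      (\<Sum>i\<in>UNIV. cnj (y $ i) * (\<Sum>j\<in>UNIV. ?S $ i $ j * y $ j))"
      unfolding cp unfolding p_def S sum_2
      by (simp add: distrib_left distrib_right l)
    then have p0: "p k = 0" for k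
      using target_functional_square[OF assms, of a "xi s a t0" t0 p k] y by simp
    have "transpose (mpoly_lead_coeff P) *v (\<chi> i. cnj (y $ i)) = 0"
    proof -
      have "(\<Sum>i\<in>UNIV. cnj (y $ i) * coeff (P $ i $ k) n) = 0" for k n
        using arg_cong[OF p0[of k], of "\<lambda>q. coeff q n"] by (simp add: p_def coeff_sum)
      then show ?thesis
        by (simp add: vec_eq_iff matrix_vector_mult_def transpose_def mpoly_lead_coeff_def mult.commute)
    qed
    moreover have "invertible (transpose (mpoly_lead_coeff P))"
      using P by (simp add: invertible_det_nz det_transpose)
    ultimately have "(\<chi> i. cnj (y $ i)) = 0"
      unfolding invertible_left_inverse matrix_left_invertible_ker by blast
    then show "y = 0" by (simp add: vec_eq_iff)
  qed
qed


lemma symmetric_wrt_target: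
  assumes "a \<noteq> 0" "s \<in> {1, - 1}" "\<gamma> \<ge> 0" "\<zeta> \<ge> 0"
  shows "symmetric_wrt (D_op s a t0) (target_measure s a t0 \<gamma> \<zeta>)"
proof -
  let ?c = "xi (- s) a t0"
  note r = xi_relations[OF assms(2), of a t0]
  have c2: "(complex_of_real ?c)\<^sup>2 = complex_of_real a * complex_of_real t0 * complex_of_real ?c + 1"
    using arg_cong[OF r(2), of complex_of_real] by simp
  have L: "moment_functional (target_measure s a t0 \<gamma> \<zeta>) =
    target_functional (complex_of_real a) (complex_of_real a * complex_of_real t0 - complex_of_real ?c)
      (complex_of_real t0) (complex_of_real \<gamma>) (complex_of_real \<zeta>)"
    by (simp add: fun_eq_iff target_measure_poly(2) r(1))
  show ?thesis
    unfolding symmetric_wrt_D_op_iff[OF psd_measure_target[OF assms(3,4)] finite_moments_target] L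
    using assms(1) r(3) c2 by (intro moment_equations_target) simp_all
qed

lemma signed_integral_real:
  assumes "\<And>t. Im (f t) = 0" shows "Im (signed_integral \<nu> f) = 0"
proof -
  have f: "f = (\<lambda>t. complex_of_real (Re (f t)))" using assms by (simp add: fun_eq_iff complex_eq_iff)
  show ?thesis unfolding signed_integral_def by (subst (1 2) f) (simp only: integral_complex_of_real, simp)
qed

text \<open>
  The entries \<open>(k, l)\<close> and \<open>(l, k)\<close> of \<open>W\<close> are conjugate, so equality of their functionals at a real
  polynomial cancels the contribution of the imaginary part; for \<open>k = l\<close> the equality is trivial.
\<close>

lemma moment_functional_real:
  assumes psd: "psd_measure W" and p: "cnj_poly p = p"
    and sym: "moment_functional W k l p = moment_functional W l k p"
  shows "Im (moment_functional W k l p) = 0"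
proof -
  let ?f = "\<lambda>t. poly p (complex_of_real t)"
  have "Im (?f t) = 0" for t
    using poly_cnj_poly_of_real[of p t] unfolding p by (simp add: complex_eq_iff)
  then have re: "Im (signed_integral \<nu> ?f) = 0" for \<nu>
    by (rule signed_integral_real)
  have "moment_functional W k l p = signed_integral (\<lambda>A. Re (W A $ k $ l)) ?f + \<i> * signed_integral (\<lambda>A. Im (W A $ k $ l)) ?f"
    by (simp add: moment_functional_def cmeasure_integral_def)
  moreover have "moment_functional W l k p = signed_integral (\<lambda>A. Re (W A $ k $ l)) ?f - \<i> * signed_integral (\<lambda>A. Im (W A $ k $ l)) ?f"
    unfolding moment_functional_def cmeasure_integral_def psd_measure_hermitian[OF psd, of _ l k]
    by (simp add: signed_integral_uminus)
  ultimately show ?thesis using sym re by simp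
qed

lemma moment_functional_diag_square:
  assumes psd: "psd_measure W" and fm: "finite_moments W"
  shows "0 \<le> Re (moment_functional W k k (p * cnj_poly p))"
proof -
  obtain M where M: "finite_measure M" "sets M = sets borel"
    "quad_form W (axis k 1 + axis k 0) = (\<lambda>A. complex_of_real (measure M A))"
    using psd_measure_quad_form[OF psd] by blast
  have e: "(\<lambda>A. W A $ k $ k) = (\<lambda>A. complex_of_real (measure M A))"
    using M(3) unfolding fun_eq_iff quad_form_axis by simp
  let ?f = "\<lambda>t. poly (p * cnj_poly p) (complex_of_real t)"
  note c = cmeasure_of_measure[OF M(1,2) poly_of_real_measurable[of "p * cnj_poly p"], folded e]
  have i: "cmeasure_integrable (\<lambda>A. W A $ k $ k) ?f"
    using fm by (intro cmeasure_integrable_poly psd_measure_finite_cmeasure psd) (auto simp: finite_moments_def)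
  have f: "?f t = complex_of_real ((cmod (poly p (complex_of_real t)))\<^sup>2)" for t
    by (simp add: complex_norm_square del: of_real_power)
  have "moment_functional W k k (p * cnj_poly p) = complex_of_real (LINT t|M. (cmod (poly p (complex_of_real t)))\<^sup>2)"
    unfolding moment_functional_def c(3)[OF i] unfolding f integral_complex_of_real ..
  then show ?thesis by simp
qed

lemma symmetric_weight_is_target:
  assumes a: "a \<noteq> 0" and s: "s \<in> {1, - 1}" and W: "weight_matrix W" and sym: "symmetric_wrt (D_op s a t0) W"
  obtains \<gamma> \<zeta> where "\<gamma> > 0" "\<zeta> \<ge> 0" "W = target_measure s a t0 \<gamma> \<zeta>"
proof -
  have psd: "psd_measure W" and fm: "finite_moments W"
    and ns: "\<And>P. invertible (mpoly_lead_coeff P) \<Longrightarrow> invertible (sandwich_integral (mpoly_eval P) W (mpoly_eval P))"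
    using W by (auto simp: weight_matrix_iff)
  let ?c = "xi (- s) a t0"
  let ?L = "moment_functional W"
  note r = xi_relations[OF s, of a t0]
  have c: "(complex_of_real ?c)\<^sup>2 = complex_of_real a * complex_of_real t0 * complex_of_real ?c + 1"
    "complex_of_real ?c \<noteq> 0" "2 + complex_of_real a * complex_of_real ?c * complex_of_real t0 \<noteq> 0"
  proof -
    show "(complex_of_real ?c)\<^sup>2 = complex_of_real a * complex_of_real t0 * complex_of_real ?c + 1"
      using arg_cong[OF r(2), of complex_of_real] by simp
    show "complex_of_real ?c \<noteq> 0" using r(3) by simp
    have "complex_of_real (2 + a * ?c * t0) \<noteq> 0" using r(4) unfolding of_real_eq_0_iff .
    then show "2 + complex_of_real a * complex_of_real ?c * complex_of_real t0 \<noteq> 0" by simp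
  qed
  have lin: "poly_functional (?L i j)" for i j
    by (rule poly_functional_moment_functional[OF psd fm])
  note me = sym[unfolded symmetric_wrt_D_op_iff[OF psd fm]]
  define \<zeta>c where "\<zeta>c = - (?L 1 2 1 - complex_of_real a * ?L 2 2 [:0, 1:]) / complex_of_real ?c"
  define \<gamma>c where "\<gamma>c = (?L 2 2 1 - \<zeta>c) / complex_of_real (sqrt pi)"
  note imp = moment_equations_imp_target[OF lin me c, folded \<zeta>c_def, folded \<gamma>c_def]
  have im: "Im (?L 1 2 1) = 0" "Im (?L 2 2 1) = 0" "Im (?L 2 2 [:0, 1:]) = 0"
    using imp(1) by (auto intro!: moment_functional_real[OF psd] simp: map_poly_pCons)
  define \<gamma> \<zeta> where "\<gamma> = Re \<gamma>c" and "\<zeta> = Re \<zeta>c"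
  have "Im \<zeta>c = 0" unfolding \<zeta>c_def using im by (simp add: Im_divide_of_real)
  then have \<zeta>: "\<zeta>c = complex_of_real \<zeta>" by (simp add: \<zeta>_def complex_eq_iff)
  have "Im \<gamma>c = 0" unfolding \<gamma>c_def \<zeta> using im by (simp add: Im_divide_of_real)
  then have \<gamma>: "\<gamma>c = complex_of_real \<gamma>" by (simp add: \<gamma>_def complex_eq_iff)
  have L: "?L k l p = target_functional a (xi s a t0) t0 \<gamma> \<zeta> k l p" for k l p
    using imp(2)[of k l] by (simp add: \<gamma> \<zeta> r(1))
  define p where "p = [:- complex_of_real t0, 1:]"
  have cp: "cnj_poly p = p" by (simp add: p_def map_poly_pCons)
  have pt: "poly p (complex_of_real t0) = 0" by (simp add: p_def)
  have "p \<noteq> 0" by (simp add: p_def)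
  then have g: "0 < Re (gauss_functional (p * cnj_poly p))"
    using gauss_functional_square[of p] by (metis complex_eq_iff order_le_imp_less_or_eq zero_complex.sel)
  have "Re (?L 2 2 (p * cnj_poly p)) = \<gamma> * Re (gauss_functional (p * cnj_poly p))"
    unfolding L target_functional_def by (simp add: weight_poly_def pt)
  then have \<gamma>0: "0 \<le> \<gamma>"
    using moment_functional_diag_square[OF psd fm, of 2 p] g by (simp add: zero_le_mult_iff)
  have "\<gamma> \<noteq> 0"
  proof
    assume \<gamma>: "\<gamma> = 0"
    \<comment> \<open>For \<open>\<gamma> = 0\<close> only the point mass remains, and it is annihilated by \<open>(t - t\<^sub>0) I\<close>.\<close>
    define P :: "complex poly^2^2" where "P = vector [vector [p, 0], vector [0, p]]"
    have "x \<in> {degree (P $ i $ j) | i j. True} \<longleftrightarrow> x \<in> {0, 1}" for x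
    proof -
      have "x \<in> {degree (P $ i $ j) | i j. True} \<longleftrightarrow> \<not> (\<forall>i j. x \<noteq> degree (P $ i $ j))" by auto
      also have "\<dots> \<longleftrightarrow> x \<in> {0, 1}"
        unfolding forall_2 by (auto simp: P_def p_def)
      finally show ?thesis .
    qed
    then have "{degree (P $ i $ j) | i j. True} = {0, 1}" by (rule set_eqI)
    then have d: "mpoly_degree P = 1" by (simp add: mpoly_degree_def)
    have "mpoly_lead_coeff P = mat 1"
      unfolding vec_eq_iff forall_2 mpoly_lead_coeff_def d by (simp add: P_def p_def mat_def)
    then have "invertible (sandwich_integral (mpoly_eval P) W (mpoly_eval P))"
      by (intro ns) (simp add: invertible_def exI[of _ "mat 1"])
    moreover have "sandwich_integral (mpoly_eval P) W (mpoly_eval P) $ i $ j = 0" for i j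
    proof -
      have "sandwich_integral (mpoly_eval P) W (mpoly_eval P) $ i $ j =
        (\<Sum>k\<in>UNIV. \<Sum>l\<in>UNIV. ?L k l (P $ i $ k * cnj_poly (P $ j $ l)))"
        by (rule sandwich_integral_poly) (simp_all add: mpoly_eval_def)
      also have "\<dots> = 0"
        unfolding L target_functional_def \<gamma> sum_2 using exhaust_2[of i] exhaust_2[of j]
        by (auto simp: P_def pt)
      finally show ?thesis .
    qed
    ultimately obtain B where "B ** (0 :: complex^2^2) = mat 1"
      unfolding invertible_left_inverse by (metis vec_eq_iff zero_index)
    then have "(B ** (0 :: complex^2^2)) $ 1 $ 1 = (mat 1 :: complex^2^2) $ 1 $ 1"
      by (rule arg_cong)
    then show False by (simp add: matrix_matrix_mult_def mat_def)
  qed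
  with \<gamma>0 have \<gamma>pos: "0 < \<gamma>" by simp
  \<comment> \<open>The sign of \<open>\<zeta>\<close> is not known yet: a negative point mass is moved to the side of \<open>W\<close>.\<close>
  define z where "z = max 0 (- \<zeta>)"
  have z: "0 \<le> z" "0 \<le> \<zeta> + z" by (auto simp: z_def)
  let ?Z = "target_measure s a t0 0 z" and ?V = "target_measure s a t0 \<gamma> (\<zeta> + z)"
  have psdZ: "psd_measure ?Z" and psdV: "psd_measure ?V"
    using z \<gamma>pos by (auto intro!: psd_measure_target)
  have "(\<lambda>\<Omega>. W \<Omega> + ?Z \<Omega>) = ?V"
  proof (rule psd_measure_eqI_moments)
    show "psd_measure (\<lambda>\<Omega>. W \<Omega> + ?Z \<Omega>)" by (rule psd_measure_add[OF psd psdZ])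
    show "finite_moments (\<lambda>\<Omega>. W \<Omega> + ?Z \<Omega>)" by (rule moment_functional_add(1)[OF psd psdZ fm finite_moments_target])
    show "moment_functional (\<lambda>\<Omega>. W \<Omega> + ?Z \<Omega>) k l (monom 1 n) = moment_functional ?V k l (monom 1 n)" for k l n
      unfolding moment_functional_add(2)[OF psd psdZ fm finite_moments_target] L target_measure_poly(2)
      by (simp add: target_functional_def algebra_simps)
  qed (auto intro: psdV finite_moments_target target_measure_exp_integrable)
  then have "W \<Omega> + ?Z \<Omega> = ?V \<Omega>" for \<Omega> by (rule fun_cong)
  then have WT: "W = target_measure s a t0 \<gamma> \<zeta>"
    by (auto simp: fun_eq_iff target_measure_def algebra_simps)
  have "0 \<le> \<zeta>"
  proof -
    have n: "gauss_part n {t0} = 0" for n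
    proof -
      have "AE t in lborel. indicat_real {t0} t *\<^sub>R (exp (- t\<^sup>2) * t ^ n) = 0"
        using AE_lborel_singleton[of t0] by eventually_elim simp
      then show ?thesis
        by (simp add: gauss_part_def set_lebesgue_integral_def integral_eq_zero_AE)
    qed
    have "pos_semidef (W {t0})" using psd by (simp add: psd_measure_def)
    then have "0 \<le> Re (\<Sum>i\<in>UNIV. \<Sum>j\<in>UNIV. cnj (axis 2 1 $ i) * W {t0} $ i $ j * axis 2 1 $ j)"
      by (simp only: pos_semidef_def)
    also have "\<dots> = \<zeta>"
      unfolding WT target_measure_eq sum_2 n by (simp add: axis_def dirac_part_def M_mat_def scaleR_conv_of_real[where 'a = complex])
    finally show ?thesis .
  qed
  with \<gamma>pos show thesis using WT by (rule that)
qed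

theorem mainTheorem3:
  fixes a t0 s :: real
  assumes "a \<noteq> 0" and "s \<in> {1, -1}"
  shows "Upsilon (D_op s a t0) =
    {\<lambda>\<Omega>. \<gamma> *\<^sub>R density_measure (W_density a) \<Omega> + \<zeta> *\<^sub>R dirac_measure t0 (M_mat s a t0) \<Omega> | \<gamma> \<zeta>.
       \<gamma> > 0 \<and> \<zeta> \<ge> 0}"
proof -
  have "W \<in> Upsilon (D_op s a t0) \<longleftrightarrow> (\<exists>\<gamma> \<zeta>. W = target_measure s a t0 \<gamma> \<zeta> \<and> \<gamma> > 0 \<and> \<zeta> \<ge> 0)" for W
  proof
    assume "W \<in> Upsilon (D_op s a t0)"
    then have W: "weight_matrix W" "symmetric_wrt (D_op s a t0) W" by (auto simp: Upsilon_def)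
    obtain \<gamma> \<zeta> where "\<gamma> > 0" "\<zeta> \<ge> 0" "W = target_measure s a t0 \<gamma> \<zeta>"
      using symmetric_weight_is_target[OF assms W] .
    then show "\<exists>\<gamma> \<zeta>. W = target_measure s a t0 \<gamma> \<zeta> \<and> \<gamma> > 0 \<and> \<zeta> \<ge> 0" by blast
  next
    assume "\<exists>\<gamma> \<zeta>. W = target_measure s a t0 \<gamma> \<zeta> \<and> \<gamma> > 0 \<and> \<zeta> \<ge> 0"
    then show "W \<in> Upsilon (D_op s a t0)"
      using weight_matrix_target symmetric_wrt_target[OF assms] by (auto simp: Upsilon_def)
  qed
  then show ?thesis by (auto simp: target_measure_def)
qed

end
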